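(* There exists an absolute constant $C>0$ such that for every $\delta\in(0,1)$, $$\inf_{\mu}\Big(\inf\big\{\mathbb{E}_{\mu^N}[\mu((1+\delta)K_N)] : N\geq \exp\big(C\delta^{-1}\ln(2/\delta)\,n\ln n\big)\big\}\Big)\longrightarrow 1\quad\text{as } n\to\infty,$$ where the outer infimum is over all log-concave probability measures $\mu$ on $\mathbb{R}^n$ with barycenter at the origin, and $K_N=\mathrm{conv}\{X_1,\ldots,X_N\}$ with $X_1,X_2,\ldots$ independent random points distributed according to $\mu$.
   Context: A log-concave probability measure on $\mathbb{R}^n$ is a Borel probability measure $\mu$ such that $\mu(\lambda A+(1-\lambda)B)\geq \mu(A)^{\lambda}\mu(B)^{1-\lambda}$ for all compact $A,B$ and $\lambda\in(0,1)$, and $\mu(H)<1$ for every hyperplane $H$. *)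

theory Defs
  imports "HOL-Probability.Probability"
begin

text \<open>R^n is represented inside the type nat => real (product topology, Borel sets)
  as the closed subspace of vectors vanishing at every index >= n.\<close>

definition Rn :: "nat \<Rightarrow> (nat \<Rightarrow> real) set" where
  "Rn n = {x. \<forall>i\<ge>n. x i = 0}"

definition minkowski_comb :: "real \<Rightarrow> (nat \<Rightarrow> real) set \<Rightarrow> (nat \<Rightarrow> real) set \<Rightarrow> (nat \<Rightarrow> real) set" where
  "minkowski_comb l A B = {(\<lambda>i. l * a i + (1 - l) * b i) | a b. a \<in> A \<and> b \<in> B}"

definition hyperplane_Rn :: "nat \<Rightarrow> (nat \<Rightarrow> real) \<Rightarrow> real \<Rightarrow> (nat \<Rightarrow> real) set" where
  "hyperplane_Rn n a c = {x \<in> Rn n. (\<Sum>i<n. a i * x i) = c}"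

definition log_concave_prob :: "nat \<Rightarrow> (nat \<Rightarrow> real) measure \<Rightarrow> bool" where
  "log_concave_prob n \<mu> \<longleftrightarrow>
     prob_space \<mu> \<and> sets \<mu> = sets borel \<and> measure \<mu> (Rn n) = 1 \<and>
     (\<forall>A B l. compact A \<and> compact B \<and> A \<subseteq> Rn n \<and> B \<subseteq> Rn n \<and> 0 < l \<and> l < 1 \<longrightarrow>
        measure \<mu> (minkowski_comb l A B) \<ge> measure \<mu> A powr l * measure \<mu> B powr (1 - l)) \<and>
     (\<forall>a c. (\<exists>i<n. a i \<noteq> 0) \<longrightarrow> measure \<mu> (hyperplane_Rn n a c) < 1)"

definition barycenter_origin :: "nat \<Rightarrow> (nat \<Rightarrow> real) measure \<Rightarrow> bool" where
  "barycenter_origin n \<mu> \<longleftrightarrow>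
     (\<forall>i<n. integrable \<mu> (\<lambda>x. x i) \<and> (\<integral>x. x i \<partial>\<mu>) = 0)"

definition scaled_hull :: "real \<Rightarrow> nat \<Rightarrow> (nat \<Rightarrow> nat \<Rightarrow> real) \<Rightarrow> (nat \<Rightarrow> real) set" where
  "scaled_hull t N X = {(\<lambda>i. t * (\<Sum>j<N. w j * X j i)) | w.
      (\<forall>j<N. 0 \<le> w j) \<and> (\<Sum>j<N. w j) = 1}"

definition expected_cover :: "(nat \<Rightarrow> real) measure \<Rightarrow> nat \<Rightarrow> real \<Rightarrow> real" where
  "expected_cover \<mu> N d =
     (\<integral>X. measure \<mu> (scaled_hull (1 + d) N X) \<partial>(PiM {..<N} (\<lambda>_. \<mu>)))"

end

theory Submission
  imports Defs "HOL-Real_Asymp.Real_Asymp"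
begin

text \<open>
  Choose coordinates in which \<open>\<mu>\<close> is isotropic, and let \<open>T\<close> be a grid of \<open>n\<^bsup>O(n)\<^esup>\<close> directions. For
  \<open>b \<in> T\<close> consider the \<open>q\<close>-quantile of the functional \<open>\<langle>b, \<cdot>\<rangle>\<close> truncated to a ball of polynomial
  radius, with \<open>q\<close> a little smaller than the inverse of the size of \<open>T\<close>. A union bound over \<open>T\<close>
  shows that most points lie below all these quantiles, while most samples contain, for every \<open>b\<close>,
  a point above the quantile. If a typical point could be separated from \<open>(1 + \<delta>) K\<^sub>N\<close>, rounding the
  separating unit direction to \<open>T\<close> would give a contradiction, because the factor \<open>1 + \<delta>\<close> absorbs
  the rounding error. Log-concavity enters only through Borell's lemma: it makes the first two
  moments of a linear functional comparable, so that every half-space at a small constant distance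
  from the barycenter carries constant mass.

  The infimum over an empty family is a junk value, so a centered log-concave measure must exist in
  every dimension; the uniform measure on the cube is one by the Prekopa--Leindler inequality.
\<close>

subsection \<open>Linear functionals and separation in \<open>\<real>\<^sup>n\<close>\<close>

definition inner_Rn :: "nat \<Rightarrow> (nat \<Rightarrow> real) \<Rightarrow> (nat \<Rightarrow> real) \<Rightarrow> real" where
  "inner_Rn n a x = (\<Sum>i<n. a i * x i)"

lemma inner_Rn_commute: "inner_Rn n a x = inner_Rn n x a"
  by (simp add: inner_Rn_def mult.commute)

lemma inner_Rn_right_linear:
  "inner_Rn n a (\<lambda>i. x i + y i) = inner_Rn n a x + inner_Rn n a y"
  "inner_Rn n a (\<lambda>i. x i - y i) = inner_Rn n a x - inner_Rn n a y"
  "inner_Rn n a (\<lambda>i. c * x i) = c * inner_Rn n a x"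
  "inner_Rn n a (\<lambda>i. - x i) = - inner_Rn n a x"
  "inner_Rn n a (\<lambda>i. \<Sum>j\<in>J. z j i) = (\<Sum>j\<in>J. inner_Rn n a (z j))"
  by (simp_all add: inner_Rn_def sum.distrib sum_subtractf sum_negf algebra_simps sum_distrib_left
      sum.swap[of _ J])

lemma inner_Rn_left_linear:
  "inner_Rn n (\<lambda>i. x i + y i) a = inner_Rn n x a + inner_Rn n y a"
  "inner_Rn n (\<lambda>i. x i - y i) a = inner_Rn n x a - inner_Rn n y a"
  "inner_Rn n (\<lambda>i. c * x i) a = c * inner_Rn n x a"
  "inner_Rn n (\<lambda>i. - x i) a = - inner_Rn n x a"
  "inner_Rn n (\<lambda>i. \<Sum>j\<in>J. z j i) a = (\<Sum>j\<in>J. inner_Rn n (z j) a)"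
  by (simp_all add: inner_Rn_commute[of n _ a] inner_Rn_right_linear)

lemma inner_Rn_self_nonneg: "0 \<le> inner_Rn n x x"
  by (auto simp: inner_Rn_def intro!: sum_nonneg)

lemma inner_Rn_self_pos_iff: "0 < inner_Rn n x x \<longleftrightarrow> (\<exists>i<n. x i \<noteq> 0)"
proof -
  have "inner_Rn n x x = 0 \<longleftrightarrow> (\<forall>i<n. x i = 0)"
    unfolding inner_Rn_def by (subst sum_nonneg_eq_0_iff) auto
  then show ?thesis
    using inner_Rn_self_nonneg[of n x] by (auto simp: less_le)
qed

lemma hyperplane_Rn_eq: "hyperplane_Rn n a c = {x \<in> Rn n. inner_Rn n a x = c}"
  by (simp add: hyperplane_Rn_def inner_Rn_def)

lemma continuous_on_inner_Rn [continuous_intros]: "continuous_on S (inner_Rn n a)"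
proof -
  have "continuous_on UNIV (inner_Rn n a)"
    unfolding inner_Rn_def by (intro continuous_intros continuous_on_product_coordinates)
  then show ?thesis by (rule continuous_on_subset) simp
qed

lemma borel_measurable_inner_Rn [measurable]: "inner_Rn n a \<in> borel_measurable borel"
  by (intro borel_measurable_continuous_onI continuous_on_inner_Rn)

lemma borel_measurable_coordinate [measurable]:
  "(\<lambda>x :: nat \<Rightarrow> real. x i) \<in> borel_measurable borel"
  by (intro borel_measurable_continuous_onI continuous_on_product_coordinates)

lemma closed_Rn: "closed (Rn n)"
proof -
  have "Rn n = (\<Inter>i\<in>{n..}. {x. x i = 0})" by (auto simp: Rn_def)
  also have "closed \<dots>"
    by (intro closed_INT ballI closed_Collect_eq continuous_on_product_coordinates continuous_on_const)
  finally show ?thesis .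
qed

lemma sets_Rn [measurable]: "Rn n \<in> sets borel"
  by (intro borel_closed closed_Rn)

lemma sets_hyperplane_Rn [measurable]: "hyperplane_Rn n a c \<in> sets borel"
proof -
  have "hyperplane_Rn n a c = {x \<in> space borel. x \<in> Rn n \<and> inner_Rn n a x = c}"
    by (simp add: hyperplane_Rn_eq)
  also have "\<dots> \<in> sets borel" by measurable
  finally show ?thesis .
qed

definition box_Rn :: "nat \<Rightarrow> real \<Rightarrow> (nat \<Rightarrow> real) set" where
  "box_Rn n r = {x \<in> Rn n. \<forall>i<n. \<bar>x i\<bar> \<le> r}"

lemma compact_box_Rn: "compact (box_Rn n r)"
proof -
  let ?B = "PiE UNIV (\<lambda>i. if i < n then {-r..r} else {0})"
  have "box_Rn n r = ?B"
    by (auto simp: box_Rn_def Rn_def PiE_def Pi_iff abs_le_iff minus_le_iff split: if_splits)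
  moreover have "compactin (product_topology (\<lambda>_. euclidean) UNIV) ?B"
    unfolding compactin_PiE by auto
  ultimately show ?thesis
    by (simp add: euclidean_product_topology)
qed

lemma compact_minkowski_comb:
  assumes "compact A" "compact B"
  shows "compact (minkowski_comb l A B)"
proof -
  let ?comb = "\<lambda>z :: (nat \<Rightarrow> real) \<times> (nat \<Rightarrow> real). \<lambda>i. l * fst z i + (1 - l) * snd z i"
  have "continuous_on (A \<times> B) ?comb"
    by (intro continuous_on_coordinatewise_then_product continuous_intros
        continuous_on_product_then_coordinatewise[OF continuous_on_fst]
        continuous_on_product_then_coordinatewise[OF continuous_on_snd])
  moreover have "minkowski_comb l A B = ?comb ` (A \<times> B)"
    by (force simp: minkowski_comb_def)
  ultimately show ?thesis
    using assms by (simp add: compact_continuous_image compact_Times)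
qed

lemma inner_Rn_nearest_point_le_0:
  assumes segment: "\<And>s. 0 < s \<Longrightarrow> s < 1 \<Longrightarrow> (\<lambda>i. s * y i + (1 - s) * p i) \<in> K"
    and nearest: "\<And>z. z \<in> K \<Longrightarrow>
      inner_Rn n (\<lambda>i. x i - p i) (\<lambda>i. x i - p i) \<le> inner_Rn n (\<lambda>i. x i - z i) (\<lambda>i. x i - z i)"
  shows "inner_Rn n (\<lambda>i. x i - p i) (\<lambda>i. y i - p i) \<le> 0"
proof -
  define d where "d = (\<lambda>i. x i - p i)"
  define e where "e = (\<lambda>i. y i - p i)"
  have "2 * inner_Rn n d e \<le> s * inner_Rn n e e" if s: "s \<in> {0<..<1}" for s
  proof -
    have "(\<lambda>i. x i - (s * y i + (1 - s) * p i)) = (\<lambda>i. d i - s * e i)"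
      by (simp add: d_def e_def algebra_simps)
    then have "inner_Rn n d d \<le> inner_Rn n (\<lambda>i. d i - s * e i) (\<lambda>i. d i - s * e i)"
      using nearest[OF segment, of s] s by (simp add: d_def)
    also have "\<dots> = inner_Rn n d d - 2 * s * inner_Rn n d e + s * (s * inner_Rn n e e)"
      by (simp add: inner_Rn_right_linear inner_Rn_left_linear inner_Rn_commute[of n e d]
          algebra_simps)
    finally show ?thesis using s by simp
  qed
  then have "\<forall>\<^sub>F s in at_right 0. 2 * inner_Rn n d e \<le> s * inner_Rn n e e"
    by (intro eventually_mono[OF eventually_at_right_real[of 0 1]]) auto
  moreover have "((\<lambda>s. s * inner_Rn n e e) \<longlongrightarrow> 0) (at_right 0)"
    by (auto intro!: tendsto_eq_intros)
  ultimately have "2 * inner_Rn n d e \<le> 0"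
    by (intro tendsto_lowerbound[of _ 0 "at_right 0"]) auto
  then show ?thesis by (simp add: d_def e_def)
qed

lemma separating_functional_compact_convex:
  assumes K: "compact K" "K \<noteq> {}" "K \<subseteq> Rn n"
    and convex: "\<And>l. 0 < l \<Longrightarrow> l < 1 \<Longrightarrow> minkowski_comb l K K \<subseteq> K"
    and x: "x \<in> Rn n" "x \<notin> K"
  obtains a where "\<And>y. y \<in> K \<Longrightarrow> inner_Rn n a y < inner_Rn n a x"
proof -
  have "continuous_on K (\<lambda>z. inner_Rn n (\<lambda>i. x i - z i) (\<lambda>i. x i - z i))"
    unfolding inner_Rn_def
    by (intro continuous_intros continuous_on_subset[OF continuous_on_product_coordinates]) auto
  from continuous_attains_inf[OF K(1,2) this] obtain p where p: "p \<in> K" and nearest: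
    "\<And>z. z \<in> K \<Longrightarrow>
      inner_Rn n (\<lambda>i. x i - p i) (\<lambda>i. x i - p i) \<le> inner_Rn n (\<lambda>i. x i - z i) (\<lambda>i. x i - z i)"
    by blast
  define d where "d = (\<lambda>i. x i - p i)"
  have "\<exists>i<n. x i \<noteq> p i"
  proof (rule ccontr)
    assume "\<not> (\<exists>i<n. x i \<noteq> p i)"
    moreover have "x i = p i" if "n \<le> i" for i
      using that x(1) p K(3) by (auto simp: Rn_def)
    ultimately have "x = p" by (metis ext not_le)
    with x(2) p show False by simp
  qed
  then have "0 < inner_Rn n d d" by (simp add: inner_Rn_self_pos_iff d_def)
  moreover have "inner_Rn n d d = inner_Rn n d x - inner_Rn n d p"
    unfolding d_def by (simp only: inner_Rn_right_linear(2))
  moreover have "inner_Rn n d y \<le> inner_Rn n d p" if y: "y \<in> K" for y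
  proof -
    have "inner_Rn n d (\<lambda>i. y i - p i) \<le> 0"
      unfolding d_def
    proof (rule inner_Rn_nearest_point_le_0[OF _ nearest])
      fix s :: real assume "0 < s" "s < 1"
      then show "(\<lambda>i. s * y i + (1 - s) * p i) \<in> K"
        using convex y p by (auto simp: minkowski_comb_def)
    qed
    then show ?thesis by (simp add: inner_Rn_right_linear)
  qed
  ultimately show thesis using that[of d] by fastforce
qed

subsection \<open>The Prekopa--Leindler inequality on the real line\<close>

lemma inner_approximation_compact_lborel:
  fixes A :: "'a::euclidean_space set"
  assumes A: "A \<in> fmeasurable lborel" "A \<noteq> {}" and e_pos: "0 < e"
  obtains K where "compact K" "K \<noteq> {}" "K \<subseteq> A" "measure lborel A - e < measure lborel K"
proof (cases "measure lborel A < e")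
  case True
  obtain p where "p \<in> A" using A(2) by blast
  with True that[of "{p}"] show thesis by simp
next
  case False
  let ?M = "density lborel (indicator A)"
  have A_borel: "A \<in> sets lborel" using A(1) by auto
  have restr: "emeasure ?M B = emeasure lborel (A \<inter> B)" if "B \<in> sets borel" for B
    using A_borel that by (simp add: emeasure_restricted)
  have "ennreal (measure lborel A - e) < emeasure ?M A"
    using A(1) A_borel e_pos False by (simp add: restr emeasure_eq_measure2 ennreal_less_iff)
  also have "emeasure ?M A = (SUP K\<in>{K. K \<subseteq> A \<and> compact K}. emeasure ?M K)"
    using A A_borel by (intro inner_regular) (auto simp: restr fmeasurable_def)
  finally obtain K where K: "K \<subseteq> A" "compact K" "ennreal (measure lborel A - e) < emeasure ?M K"
    unfolding less_SUP_iff by blast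
  have "emeasure ?M K = ennreal (measure lborel K)"
    using K(1,2) fmeasurable_compact[OF K(2)]
    by (simp add: restr borel_compact Int_absorb1 emeasure_eq_measure2)
  with K(3) False have "measure lborel A - e < measure lborel K"
    by (simp add: ennreal_less_iff)
  moreover from this False have "K \<noteq> {}" by auto
  ultimately show thesis using K that by blast
qed

lemma measure_lborel_affine_image_compact:
  fixes S :: "real set"
  assumes "compact S" "0 < k"
  shows "measure lborel ((\<lambda>x. k * x + c) ` S) = k * measure lborel S"
proof -
  have "compact ((\<lambda>x. k * x + c) ` S)"
    using assms by (intro compact_continuous_image continuous_intros)
  then show ?thesis
    using assms measure_lebesgue_affine[of k c S] by (simp add: borel_compact)
qed

lemma brunn_minkowski_compact_real:
  fixes A B C :: "real set"
  assumes A: "compact A" "A \<noteq> {}" and B: "compact B" "B \<noteq> {}" and C: "C \<in> fmeasurable lborel"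
    and l_bounds: "0 < l" "l < 1"
    and combination_in: "\<And>a b. a \<in> A \<Longrightarrow> b \<in> B \<Longrightarrow> l * a + (1 - l) * b \<in> C"
  shows "l * measure lborel A + (1 - l) * measure lborel B \<le> measure lborel C"
proof -
  obtain a where a_max: "a \<in> A" "\<And>x. x \<in> A \<Longrightarrow> x \<le> a" using compact_attains_sup[OF A] by blast
  obtain b where b_min: "b \<in> B" "\<And>y. y \<in> B \<Longrightarrow> b \<le> y" using compact_attains_inf[OF B] by blast
  define A' where "A' = (\<lambda>x. l * x + (1 - l) * b) ` A"
  define B' where "B' = (\<lambda>y. (1 - l) * y + l * a) ` B"
  have compact': "compact A'" "compact B'"
    unfolding A'_def B'_def using A(1) B(1)
    by (auto intro!: compact_continuous_image continuous_intros)
  have "A' \<inter> B' \<subseteq> {l * a + (1 - l) * b}"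
  proof
    fix z assume "z \<in> A' \<inter> B'"
    then obtain x y where "x \<in> A" "z = l * x + (1 - l) * b" and "y \<in> B" "z = (1 - l) * y + l * a"
      unfolding A'_def B'_def by blast
    moreover from this have "l * x \<le> l * a" "(1 - l) * b \<le> (1 - l) * y"
      using a_max b_min l_bounds by (auto intro!: mult_left_mono)
    ultimately have "z = l * a + (1 - l) * b" by linarith
    then show "z \<in> {l * a + (1 - l) * b}" by simp
  qed
  then have "emeasure lborel (A' \<inter> B') \<le> emeasure lborel {l * a + (1 - l) * b}"
    by (intro emeasure_mono) auto
  then have overlap: "measure lborel (A' \<inter> B') = 0" by (simp add: measure_def)
  have "l * measure lborel A + (1 - l) * measure lborel B = measure lborel A' + measure lborel B'"
    unfolding A'_def B'_def using A(1) B(1) l_bounds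
    by (simp add: measure_lborel_affine_image_compact)
  also have "\<dots> = measure lborel (A' \<union> B')"
    using compact' overlap by (simp add: measure_Un3 fmeasurable_compact)
  also have "\<dots> \<le> measure lborel C"
    using compact' C combination_in a_max(1) b_min(1)
    by (intro measure_mono_fmeasurable) (auto simp: A'_def B'_def borel_compact algebra_simps)
  finally show ?thesis .
qed

lemma brunn_minkowski_real:
  fixes A B C :: "real set"
  assumes A: "A \<in> fmeasurable lborel" "A \<noteq> {}" and B: "B \<in> fmeasurable lborel" "B \<noteq> {}"
    and C: "C \<in> fmeasurable lborel" and l_bounds: "0 < l" "l < 1"
    and combination_in: "\<And>a b. a \<in> A \<Longrightarrow> b \<in> B \<Longrightarrow> l * a + (1 - l) * b \<in> C"
  shows "l * measure lborel A + (1 - l) * measure lborel B \<le> measure lborel C"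
proof (rule field_le_epsilon)
  fix e :: real assume e_pos: "0 < e"
  obtain K where K: "compact K" "K \<noteq> {}" "K \<subseteq> A" "measure lborel A - e < measure lborel K"
    using inner_approximation_compact_lborel[OF A e_pos] .
  obtain L where L: "compact L" "L \<noteq> {}" "L \<subseteq> B" "measure lborel B - e < measure lborel L"
    using inner_approximation_compact_lborel[OF B e_pos] .
  have "l * (measure lborel A - e) + (1 - l) * (measure lborel B - e)
      \<le> l * measure lborel K + (1 - l) * measure lborel L"
    using K(4) L(4) l_bounds by (intro add_mono mult_left_mono) auto
  also have "\<dots> \<le> measure lborel C"
    using K L C l_bounds combination_in by (intro brunn_minkowski_compact_real) blast+
  finally show "l * measure lborel A + (1 - l) * measure lborel B \<le> measure lborel C + e"
    by (simp add: algebra_simps)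
qed

lemma measurable_emeasure_superlevel:
  fixes f :: "'a \<Rightarrow> real"
  assumes "sigma_finite_measure M" and [measurable]: "f \<in> borel_measurable M"
  shows "(\<lambda>t. emeasure M {x \<in> space M. t < f x}) \<in> borel_measurable borel"
proof -
  interpret sigma_finite_measure M by fact
  have "{z \<in> space (borel \<Otimes>\<^sub>M M). fst z < f (snd z)} \<in> sets (borel \<Otimes>\<^sub>M M)"
    by measurable
  from measurable_emeasure_Pair[OF this] show ?thesis
    by (rule measurable_cong[THEN iffD1, rotated])
       (auto intro!: arg_cong[where f = "emeasure M"] simp: space_pair_measure)
qed

lemma nn_integral_layer_cake:
  fixes f :: "'a \<Rightarrow> real"
  assumes "sigma_finite_measure M" and f[measurable]: "f \<in> borel_measurable M"
  shows "(\<integral>\<^sup>+x. ennreal (f x) \<partial>M)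
    = (\<integral>\<^sup>+t. indicator {0<..} t * emeasure M {x \<in> space M. t < f x} \<partial>lborel)"
proof -
  interpret sigma_finite_measure M by fact
  interpret pair_sigma_finite M lborel ..
  have "emeasure lborel {0<..<f x} = ennreal (f x)" for x
    by (cases "0 \<le> f x") (simp_all add: ennreal_neg)
  then have "(\<integral>\<^sup>+x. ennreal (f x) \<partial>M) = (\<integral>\<^sup>+x. (\<integral>\<^sup>+t. indicator {0<..<f x} t \<partial>lborel) \<partial>M)"
    by simp
  also have "\<dots> = (\<integral>\<^sup>+t. (\<integral>\<^sup>+x. indicator {0<..<f x} t \<partial>M) \<partial>lborel)"
  proof (rule Fubini'[symmetric])
    have "Measurable.pred (M \<Otimes>\<^sub>M lborel) (\<lambda>z. 0 < snd z \<and> snd z < f (fst z))"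
      by measurable
    then show "(\<lambda>(x, t). indicator {0<..<f x} t :: ennreal) \<in> borel_measurable (M \<Otimes>\<^sub>M lborel)"
      by (simp add: indicator_def case_prod_beta)
  qed
  also have "\<dots> = (\<integral>\<^sup>+t. (\<integral>\<^sup>+x. indicator {0<..} t * indicator {x \<in> space M. t < f x} x \<partial>M) \<partial>lborel)"
    by (intro nn_integral_cong) (auto split: split_indicator)
  also have "\<dots> = (\<integral>\<^sup>+t. indicator {0<..} t * emeasure M {x \<in> space M. t < f x} \<partial>lborel)"
    by (intro nn_integral_cong) (simp add: nn_integral_cmult)
  finally show ?thesis .
qed

lemma fmeasurable_superlevel:
  fixes f :: "'a \<Rightarrow> real"
  assumes f: "integrable M f" and t_pos: "0 < t"
  shows "{x \<in> space M. t < f x} \<in> fmeasurable M"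
proof -
  have [measurable]: "f \<in> borel_measurable M" using f by simp
  have "emeasure M {x \<in> space M. t < f x} \<le> emeasure M {x \<in> space M. t \<le> \<bar>f x\<bar>}"
    by (intro emeasure_mono) auto
  also have "\<dots> \<le> ennreal (1 / t * (\<integral>x. \<bar>f x\<bar> \<partial>M))"
    using f t_pos by (intro integral_Markov_inequality) auto
  finally show ?thesis
    by (auto simp: fmeasurable_def le_less_trans)
qed

lemma integral_layer_cake:
  fixes f :: "'a \<Rightarrow> real"
  assumes "sigma_finite_measure M" and f: "integrable M f" "\<And>x. 0 \<le> f x"
  shows "ennreal (\<integral>x. f x \<partial>M)
    = (\<integral>\<^sup>+t. indicator {0<..} t * emeasure M {x \<in> space M. t < f x} \<partial>lborel)"
  using nn_integral_layer_cake[OF assms(1), of f] f by (simp add: nn_integral_eq_integral)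

lemma brunn_minkowski_superlevel:
  fixes f g h :: "real \<Rightarrow> real"
  assumes integrable: "integrable lborel f" "integrable lborel g" "integrable lborel h"
    and levels: "0 < t" "\<exists>x. t < f x" "\<exists>x. t < g x" and l_bounds: "0 < l" "l < 1"
    and combination_le: "\<And>x y. f x powr l * g y powr (1 - l) \<le> h (l * x + (1 - l) * y)"
  shows "ennreal l * emeasure lborel {x. t < f x} + ennreal (1 - l) * emeasure lborel {x. t < g x}
    \<le> emeasure lborel {x. t < h x}"
proof -
  have superlevel: "{x. t < u x} \<in> fmeasurable lborel" if "integrable lborel u"
    for u :: "real \<Rightarrow> real"
    using fmeasurable_superlevel[OF that levels(1)] by simp
  have "l * measure lborel {x. t < f x} + (1 - l) * measure lborel {x. t < g x}
      \<le> measure lborel {x. t < h x}"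
  proof (rule brunn_minkowski_real[OF superlevel _ superlevel _ superlevel l_bounds])
    fix x y assume "x \<in> {x. t < f x}" "y \<in> {x. t < g x}"
    then have "t powr l * t powr (1 - l) < f x powr l * g y powr (1 - l)"
      using levels(1) l_bounds by (intro mult_strict_mono powr_less_mono2) auto
    moreover have "t powr l * t powr (1 - l) = t" using levels(1) by (simp flip: powr_add)
    ultimately show "l * x + (1 - l) * y \<in> {x. t < h x}" using combination_le[of x y] by simp
  qed (use integrable levels in auto)
  then have "ennreal (l * measure lborel {x. t < f x} + (1 - l) * measure lborel {x. t < g x})
      \<le> ennreal (measure lborel {x. t < h x})"
    by (rule ennreal_leI)
  then show ?thesis
    using l_bounds superlevel integrable
    by (simp add: emeasure_eq_measure2 ennreal_mult ennreal_plus)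
qed

text \<open>Functions with supremum 1 have nonempty superlevel sets at every level below 1, so the
  Brunn--Minkowski inequality can be integrated over the levels.\<close>

lemma prekopa_leindler_real_normalized:
  fixes f g h :: "real \<Rightarrow> real"
  assumes integrable: "integrable lborel f" "integrable lborel g" "integrable lborel h"
    and nonneg: "\<And>x. 0 \<le> f x" "\<And>x. 0 \<le> g x" "\<And>x. 0 \<le> h x"
    and le_1: "\<And>x. f x \<le> 1" "\<And>x. g x \<le> 1"
    and sup_1: "\<And>t. t < 1 \<Longrightarrow> \<exists>x. t < f x" "\<And>t. t < 1 \<Longrightarrow> \<exists>x. t < g x"
    and l_bounds: "0 < l" "l < 1"
    and combination_le: "\<And>x y. f x powr l * g y powr (1 - l) \<le> h (l * x + (1 - l) * y)"
  shows "l * (\<integral>x. f x \<partial>lborel) + (1 - l) * (\<integral>x. g x \<partial>lborel) \<le> (\<integral>x. h x \<partial>lborel)"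
proof -
  let ?F = "\<lambda>u t. indicator {0<..} t * emeasure lborel {x. t < u x} :: ennreal"
  have sigma_finite: "sigma_finite_measure (lborel :: real measure)" ..
  have cake: "ennreal (\<integral>x. u x \<partial>lborel) = (\<integral>\<^sup>+t. ?F u t \<partial>lborel)"
    if "integrable lborel u" "\<And>x. 0 \<le> u x" for u :: "real \<Rightarrow> real"
    using integral_layer_cake[OF sigma_finite that] by simp
  have F_measurable: "?F u \<in> borel_measurable borel" if "integrable lborel u" for u :: "real \<Rightarrow> real"
    using that measurable_emeasure_superlevel[OF sigma_finite, of u] by simp
  have level: "ennreal l * ?F f t + ennreal (1 - l) * ?F g t \<le> ?F h t" for t
  proof (cases "0 < t \<and> t < 1")
    case True
    then show ?thesis
      using brunn_minkowski_superlevel[OF integrable _ _ _ l_bounds combination_le, of t] sup_1[of t]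
      by simp
  next
    case False
    then have "{x. t < f x} = {}" "{x. t < g x} = {}" if "0 < t"
      using le_1 that order_trans[OF le_1(1)] order_trans[OF le_1(2)] by (auto simp: not_less)
    then show ?thesis by (cases "0 < t") auto
  qed
  have "ennreal (l * (\<integral>x. f x \<partial>lborel) + (1 - l) * (\<integral>x. g x \<partial>lborel))
      = ennreal l * (\<integral>\<^sup>+t. ?F f t \<partial>lborel) + ennreal (1 - l) * (\<integral>\<^sup>+t. ?F g t \<partial>lborel)"
    using l_bounds integrable nonneg
    by (simp add: ennreal_plus ennreal_mult integral_nonneg_AE flip: cake)
  also have "\<dots> = (\<integral>\<^sup>+t. ennreal l * ?F f t + ennreal (1 - l) * ?F g t \<partial>lborel)"
    using F_measurable integrable by (simp add: nn_integral_add nn_integral_cmult)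
  also have "\<dots> \<le> (\<integral>\<^sup>+t. ?F h t \<partial>lborel)"
    by (intro nn_integral_mono level)
  also have "\<dots> = ennreal (\<integral>x. h x \<partial>lborel)"
    using integrable nonneg by (simp flip: cake)
  finally show ?thesis
    using nonneg by (subst (asm) ennreal_le_iff) (auto intro: integral_nonneg_AE)
qed

lemma positive_supremum_of_integral_nonzero:
  fixes f :: "'a \<Rightarrow> real"
  assumes f: "\<And>x. 0 \<le> f x" "\<And>x. f x \<le> B" and nonzero: "(\<integral>x. f x \<partial>M) \<noteq> 0"
  obtains a where "0 < a" "\<forall>x. f x \<le> a" "\<forall>t<1. \<exists>x. t < f x / a"
proof -
  have upper: "f x \<le> Sup (range f)" for x
    using f(2) by (intro cSup_upper bdd_aboveI[where M = B]) auto
  have pos: "0 < Sup (range f)"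
  proof (rule ccontr)
    assume "\<not> 0 < Sup (range f)"
    then have "f x = 0" for x using upper[of x] f(1)[of x] by simp
    with nonzero show False by simp
  qed
  have "\<exists>x. t < f x / Sup (range f)" if "t < 1" for t
  proof -
    have "t * Sup (range f) < Sup (range f)" using that pos by simp
    then obtain v where "v \<in> range f" "t * Sup (range f) < v" by (rule less_cSupE) auto
    then show ?thesis using pos by (auto simp: field_simps)
  qed
  with pos upper show thesis using that by blast
qed

lemma prekopa_leindler_real_bounded:
  fixes f g h :: "real \<Rightarrow> real"
  assumes integrable: "integrable lborel f" "integrable lborel g" "integrable lborel h"
    and nonneg: "\<And>x. 0 \<le> f x" "\<And>x. 0 \<le> g x" "\<And>x. 0 \<le> h x"
    and bounds: "\<And>x. f x \<le> B" "\<And>x. g x \<le> B"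
    and l_bounds: "0 < l" "l < 1"
    and combination_le: "\<And>x y. f x powr l * g y powr (1 - l) \<le> h (l * x + (1 - l) * y)"
  shows "(\<integral>x. f x \<partial>lborel) powr l * (\<integral>x. g x \<partial>lborel) powr (1 - l) \<le> (\<integral>x. h x \<partial>lborel)"
proof (cases "(\<integral>x. f x \<partial>lborel) = 0 \<or> (\<integral>x. g x \<partial>lborel) = 0")
  case True
  then show ?thesis using nonneg by (auto intro: integral_nonneg_AE)
next
  case False
  obtain a where a_sup: "0 < a" "\<forall>x. f x \<le> a" "\<forall>t<1. \<exists>x. t < f x / a"
    using positive_supremum_of_integral_nonzero[of f, OF nonneg(1) bounds(1)] False by blast
  obtain b where b_sup: "0 < b" "\<forall>x. g x \<le> b" "\<forall>t<1. \<exists>x. t < g x / b"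
    using positive_supremum_of_integral_nonzero[of g, OF nonneg(2) bounds(2)] False by blast
  define c where "c = a powr l * b powr (1 - l)"
  have pos: "0 < a" "0 < b" "0 < c" using a_sup b_sup by (simp_all add: c_def)
  have int_pos: "0 < (\<integral>x. f x \<partial>lborel)" "0 < (\<integral>x. g x \<partial>lborel)"
    using False nonneg by (auto simp: less_le intro!: integral_nonneg_AE)
  have "((\<integral>x. f x \<partial>lborel) / a) powr l * ((\<integral>x. g x \<partial>lborel) / b) powr (1 - l)
      \<le> l * ((\<integral>x. f x \<partial>lborel) / a) + (1 - l) * ((\<integral>x. g x \<partial>lborel) / b)"
    using l_bounds pos int_pos by (intro Youngs_inequality_0) auto
  also have "\<dots> = l * (\<integral>x. f x / a \<partial>lborel) + (1 - l) * (\<integral>x. g x / b \<partial>lborel)"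
    by simp
  also have "\<dots> \<le> (\<integral>x. h x / c \<partial>lborel)"
  proof (rule prekopa_leindler_real_normalized[OF _ _ _ _ _ _ _ _ _ _ l_bounds])
    show "f x / a \<le> 1" "g x / b \<le> 1" for x
      using a_sup b_sup by simp_all
    show "\<exists>x. t < f x / a" "\<exists>x. t < g x / b" if "t < 1" for t
      using a_sup(3) b_sup(3) that by auto
    show "(f x / a) powr l * (g y / b) powr (1 - l) \<le> h (l * x + (1 - l) * y) / c" for x y
      using divide_right_mono[OF combination_le[of x y], of c] pos nonneg
      by (simp add: powr_divide c_def)
  qed (use integrable nonneg pos in auto)
  finally show ?thesis
    using pos int_pos by (simp add: powr_divide c_def field_simps)
qed

lemma integral_min_tendsto:
  fixes f :: "'a \<Rightarrow> real"
  assumes f: "integrable M f" "\<And>x. 0 \<le> f x"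
  shows "(\<lambda>k. \<integral>x. min (f x) (real k) \<partial>M) \<longlonglongrightarrow> (\<integral>x. f x \<partial>M)"
proof (rule integral_dominated_convergence[where w = f])
  have "(\<lambda>k. min (f x) (real k)) \<longlonglongrightarrow> f x" for x
  proof (rule tendsto_eventually)
    show "\<forall>\<^sub>F k in sequentially. min (f x) (real k) = f x"
      using eventually_ge_at_top[of "nat \<lceil>f x\<rceil>"] by eventually_elim linarith
  qed
  then show "AE x in M. (\<lambda>k. min (f x) (real k)) \<longlonglongrightarrow> f x" by simp
qed (use f in auto)

theorem prekopa_leindler_real:
  fixes f g h :: "real \<Rightarrow> real"
  assumes integrable: "integrable lborel f" "integrable lborel g" "integrable lborel h"
    and nonneg: "\<And>x. 0 \<le> f x" "\<And>x. 0 \<le> g x" "\<And>x. 0 \<le> h x"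
    and l_bounds: "0 < l" "l < 1"
    and combination_le: "\<And>x y. f x powr l * g y powr (1 - l) \<le> h (l * x + (1 - l) * y)"
  shows "(\<integral>x. f x \<partial>lborel) powr l * (\<integral>x. g x \<partial>lborel) powr (1 - l) \<le> (\<integral>x. h x \<partial>lborel)"
proof -
  have trunc_int: "integrable lborel (\<lambda>x. min (u x) (real k))"
    if "integrable lborel u" "\<And>x. 0 \<le> u x" for u :: "real \<Rightarrow> real" and k
    using that by (intro Bochner_Integration.integrable_bound[OF that(1)]) auto
  have "(\<lambda>k. (\<integral>x. min (f x) (real k) \<partial>lborel) powr l * (\<integral>x. min (g x) (real k) \<partial>lborel) powr (1 - l))
      \<longlonglongrightarrow> (\<integral>x. f x \<partial>lborel) powr l * (\<integral>x. g x \<partial>lborel) powr (1 - l)"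
    using l_bounds integrable nonneg
    by (intro tendsto_mult tendsto_powr' tendsto_const integral_min_tendsto) auto
  then show ?thesis
  proof (rule LIMSEQ_le_const2, intro exI allI impI)
    fix k
    show "(\<integral>x. min (f x) (real k) \<partial>lborel) powr l * (\<integral>x. min (g x) (real k) \<partial>lborel) powr (1 - l)
        \<le> (\<integral>x. h x \<partial>lborel)"
    proof (rule prekopa_leindler_real_bounded[where B = "real k",
        OF _ _ integrable(3) _ _ nonneg(3) _ _ l_bounds])
      fix x y
      have "min (f x) (real k) powr l * min (g y) (real k) powr (1 - l)
          \<le> f x powr l * g y powr (1 - l)"
        using l_bounds nonneg by (intro mult_mono powr_mono2) auto
      also note combination_le
      finally show "min (f x) (real k) powr l * min (g y) (real k) powr (1 - l)
          \<le> h (l * x + (1 - l) * y)" .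
    qed (use integrable nonneg trunc_int in auto)
  qed
qed

subsection \<open>The uniform measure on the cube\<close>

lemma integral_uniform_measure:
  fixes f :: "'a \<Rightarrow> real"
  assumes A: "A \<in> sets M" "emeasure M A \<noteq> 0" "emeasure M A \<noteq> \<infinity>" and f: "f \<in> borel_measurable M"
  shows "(\<integral>x. f x \<partial>uniform_measure M A) = (\<integral>x. indicator A x * f x \<partial>M) / measure M A"
proof -
  have emeasure_A: "emeasure M A = ennreal (measure M A)"
    using A(3) by (simp add: emeasure_eq_ennreal_measure)
  with A(2) have "0 < measure M A" by (auto simp: less_le)
  have "uniform_measure M A = density M (\<lambda>x. ennreal (indicator A x / measure M A))"
    unfolding uniform_measure_def
    using A(1) emeasure_A \<open>0 < measure M A\<close> divide_ennreal[of 1 "measure M A"]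
    by (intro density_cong) (auto split: split_indicator)
  then have "(\<integral>x. f x \<partial>uniform_measure M A) = (\<integral>x. (indicator A x / measure M A) *\<^sub>R f x \<partial>M)"
    using A f by (simp add: integral_density)
  then show ?thesis by simp
qed

definition unif :: "real measure" where
  "unif = uniform_measure lborel {-1..1}"

lemma sets_unif [simp, measurable_cong]: "sets unif = sets borel"
  by (simp add: unif_def)

lemma space_unif [simp]: "space unif = UNIV"
  by (simp add: unif_def)

interpretation unif: prob_space unif
  unfolding unif_def by (rule prob_space_uniform_measure) auto

lemma integral_unif:
  fixes f :: "real \<Rightarrow> real"
  assumes "f \<in> borel_measurable borel"
  shows "(\<integral>x. f x \<partial>unif) = (\<integral>x. indicator {-1..1} x * f x \<partial>lborel) / 2"
  using assms unfolding unif_def by (subst integral_uniform_measure) auto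

lemma AE_unif_abs_le_1: "AE t in unif. \<bar>t\<bar> \<le> 1"
  unfolding unif_def by (rule AE_uniform_measureI) auto

lemma AE_unif_neq: "AE t in unif. t \<noteq> c"
  unfolding unif_def using AE_lborel_singleton[of c]
  by (intro AE_uniform_measureI) (auto elim: eventually_mono)

lemma integrable_unif_ident: "integrable unif (\<lambda>t. t)"
  using AE_unif_abs_le_1
  by (intro unif.integrable_const_bound[where B = 1]) (auto simp: measurable_ident_sets)

lemma integral_unif_ident: "(\<integral>t. t \<partial>unif) = 0"
  using integral_power[of "-1" 1 1] by (simp add: integral_unif mult.commute)

lemma prekopa_leindler_unif:
  fixes f g h :: "real \<Rightarrow> real"
  assumes [measurable]: "f \<in> borel_measurable borel" "g \<in> borel_measurable borel"
      "h \<in> borel_measurable borel"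
    and bounds: "\<And>x. f x \<in> {0..B}" "\<And>x. g x \<in> {0..B}" "\<And>x. h x \<in> {0..B}"
    and l_bounds: "0 < l" "l < 1"
    and combination_le: "\<And>x y. f x powr l * g y powr (1 - l) \<le> h (l * x + (1 - l) * y)"
  shows "(\<integral>x. f x \<partial>unif) powr l * (\<integral>x. g x \<partial>unif) powr (1 - l) \<le> (\<integral>x. h x \<partial>unif)"
proof -
  let ?cut = "\<lambda>u x. indicator {-1..1} x * u x :: real"
  have integrable: "integrable lborel (?cut u)"
    if "u \<in> borel_measurable borel" "\<And>x. u x \<in> {0..B}" for u :: "real \<Rightarrow> real"
  proof -
    have "integrable lborel (\<lambda>x. indicator {-1..1} x *\<^sub>R u x)"
      using that by (intro integrableI_bounded_set_indicator[where B = B]) auto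
    then show ?thesis by simp
  qed
  have "(\<integral>x. ?cut f x \<partial>lborel) powr l * (\<integral>x. ?cut g x \<partial>lborel) powr (1 - l) \<le> (\<integral>x. ?cut h x \<partial>lborel)"
  proof (rule prekopa_leindler_real[OF _ _ _ _ _ _ l_bounds])
    show "?cut f x powr l * ?cut g y powr (1 - l) \<le> ?cut h (l * x + (1 - l) * y)" for x y
    proof (cases "x \<in> {-1..1} \<and> y \<in> {-1..1}")
      case True
      then have "l *\<^sub>R x + (1 - l) *\<^sub>R y \<in> {-1..1}"
        using l_bounds by (intro convexD) auto
      with True combination_le show ?thesis by simp
    next
      case False
      then have "?cut f x powr l * ?cut g y powr (1 - l) = 0" by auto
      also have "\<dots> \<le> ?cut h (l * x + (1 - l) * y)" using bounds(3) by (auto split: split_indicator)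
      finally show ?thesis .
    qed
  qed (use bounds integrable in auto)
  moreover have "0 \<le> (\<integral>x. ?cut u x \<partial>lborel)" if "\<And>x. u x \<in> {0..B}" for u
    using that by (intro integral_nonneg_AE) auto
  ultimately show ?thesis
    using bounds by (simp add: integral_unif powr_divide flip: powr_add)
qed

primrec cube_measure :: "nat \<Rightarrow> (nat \<Rightarrow> real) measure" where
  "cube_measure 0 = return borel (\<lambda>_. 0)"
| "cube_measure (Suc n) = distr (cube_measure n \<Otimes>\<^sub>M unif) borel (\<lambda>(x, t). x(n := t))"

lemma sets_cube_measure [simp, measurable_cong]: "sets (cube_measure n) = sets borel"
  by (cases n) auto

lemma space_cube_measure [simp]: "space (cube_measure n) = UNIV"
  using sets_eq_imp_space_eq[OF sets_cube_measure] by simp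

lemma measurable_fun_upd_borel [measurable]:
  "(\<lambda>(x :: nat \<Rightarrow> real, t). x(n := t)) \<in> borel_measurable (borel \<Otimes>\<^sub>M borel)"
proof -
  have "continuous_on UNIV (\<lambda>z :: (nat \<Rightarrow> real) \<times> real. (fst z)(n := snd z))"
  proof (rule continuous_on_coordinatewise_then_product)
    fix i
    show "continuous_on UNIV (\<lambda>z :: (nat \<Rightarrow> real) \<times> real. ((fst z)(n := snd z)) i)"
      by (cases "i = n")
         (auto intro!: continuous_intros continuous_on_product_then_coordinatewise[OF continuous_on_fst])
  qed
  from borel_measurable_continuous_onI[OF this] show ?thesis
    by (simp add: borel_prod case_prod_beta)
qed

lemma measurable_fun_upd_section [measurable]:
  fixes x :: "nat \<Rightarrow> real"
  shows "(\<lambda>t. x(n := t)) \<in> borel_measurable borel"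
proof -
  have "Pair x \<in> borel \<rightarrow>\<^sub>M (borel \<Otimes>\<^sub>M borel)" by (intro measurable_Pair1') simp
  from measurable_compose[OF this measurable_fun_upd_borel[of n]] show ?thesis by simp
qed

interpretation cube: prob_space "cube_measure n" for n
proof (induction n)
  case 0
  show ?case by (auto intro: prob_space_return)
next
  case (Suc n)
  interpret prob_space "cube_measure n" by fact
  interpret pair_prob_space "cube_measure n" unif ..
  show ?case unfolding cube_measure.simps by (intro prob_space_distr) measurable
qed

lemma
  fixes f :: "(nat \<Rightarrow> real) \<Rightarrow> real"
  assumes [measurable]: "f \<in> borel_measurable borel" and f: "\<And>x. \<bar>f x\<bar> \<le> B"
  shows integral_cube_measure_Suc:
      "(\<integral>x. f x \<partial>cube_measure (Suc n)) = (\<integral>x. (\<integral>t. f (x(n := t)) \<partial>unif) \<partial>cube_measure n)"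
    and borel_measurable_integral_fun_upd:
      "(\<lambda>x. \<integral>t. f (x(n := t)) \<partial>unif) \<in> borel_measurable borel"
proof -
  interpret pair_prob_space "cube_measure n" unif ..
  have [measurable]: "(\<lambda>(x, t). f (x(n := t))) \<in> borel_measurable (borel \<Otimes>\<^sub>M borel)"
    using measurable_compose[OF measurable_fun_upd_borel[of n] assms(1)]
    by (simp add: case_prod_beta)
  then have "(\<lambda>(x, t). f (x(n := t))) \<in> borel_measurable (cube_measure n \<Otimes>\<^sub>M unif)"
    by (simp cong: measurable_cong_sets sets_pair_measure_cong)
  then have integrable: "integrable (cube_measure n \<Otimes>\<^sub>M unif) (\<lambda>(x, t). f (x(n := t)))"
    using f by (intro P.integrable_const_bound[where B = B]) (auto intro!: AE_I2)
  have "(\<integral>x. f x \<partial>cube_measure (Suc n)) = (\<integral>z. f ((\<lambda>(x, t). x(n := t)) z) \<partial>(cube_measure n \<Otimes>\<^sub>M unif))"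
    unfolding cube_measure.simps by (intro integral_distr) measurable
  also have "\<dots> = (\<integral>z. (\<lambda>(x, t). f (x(n := t))) z \<partial>(cube_measure n \<Otimes>\<^sub>M unif))"
    by (simp add: case_prod_beta)
  also have "\<dots> = (\<integral>x. (\<integral>t. f (x(n := t)) \<partial>unif) \<partial>cube_measure n)"
    using integral_fst'[OF integrable] by simp
  finally show "(\<integral>x. f x \<partial>cube_measure (Suc n)) = (\<integral>x. (\<integral>t. f (x(n := t)) \<partial>unif) \<partial>cube_measure n)" .
  show "(\<lambda>x. \<integral>t. f (x(n := t)) \<partial>unif) \<in> borel_measurable borel"
    by measurable
qed

lemma AE_cube_measure_Suc:
  assumes pred_P: "Measurable.pred borel P"
    and AE_sections: "AE x in cube_measure n. AE t in unif. P (x(n := t))"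
  shows "AE x in cube_measure (Suc n). P x"
proof -
  interpret pair_prob_space "cube_measure n" unif ..
  have upd: "(\<lambda>(x, t). x(n := t)) \<in> (cube_measure n \<Otimes>\<^sub>M unif) \<rightarrow>\<^sub>M borel"
    by measurable
  have "AE z in cube_measure n \<Otimes>\<^sub>M unif. P ((\<lambda>(x, t). x(n := t)) z)"
    using AE_sections measurable_compose[OF upd pred_P]
    by (intro AE_pair_measure) (auto simp: pred_def)
  then show ?thesis unfolding cube_measure.simps
    using upd pred_P by (subst AE_distr_iff) (auto simp: pred_def)
qed

lemma integral_fun_upd_bounds:
  fixes f :: "(nat \<Rightarrow> real) \<Rightarrow> real"
  assumes f: "f \<in> borel_measurable borel" "\<And>x. f x \<in> {0..B}"
  shows "(\<integral>t. f (x(n := t)) \<partial>unif) \<in> {0..B}"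
proof -
  have "integrable unif (\<lambda>t. f (x(n := t)))"
  proof (rule unif.integrable_const_bound)
    show "AE t in unif. norm (f (x(n := t))) \<le> B" using f(2) by (auto intro!: AE_I2)
    show "(\<lambda>t. f (x(n := t))) \<in> borel_measurable unif"
      using measurable_compose[OF measurable_fun_upd_section f(1)]
      by (simp cong: measurable_cong_sets)
  qed
  then show ?thesis
    using f(2) by (auto intro!: integral_nonneg_AE unif.integral_le_const)
qed

lemma prekopa_leindler_unif_section:
  fixes f g h :: "(nat \<Rightarrow> real) \<Rightarrow> real"
  assumes meas: "f \<in> borel_measurable borel" "g \<in> borel_measurable borel"
      "h \<in> borel_measurable borel"
    and bounds: "\<And>x. f x \<in> {0..B}" "\<And>x. g x \<in> {0..B}" "\<And>x. h x \<in> {0..B}"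
    and l_bounds: "0 < l" "l < 1"
    and combination_le: "\<And>x y. f x powr l * g y powr (1 - l) \<le> h (\<lambda>i. l * x i + (1 - l) * y i)"
  shows "(\<integral>t. f (x(n := t)) \<partial>unif) powr l * (\<integral>t. g (y(n := t)) \<partial>unif) powr (1 - l)
    \<le> (\<integral>t. h ((\<lambda>i. l * x i + (1 - l) * y i)(n := t)) \<partial>unif)"
proof (rule prekopa_leindler_unif[OF _ _ _ _ _ _ l_bounds])
  fix s t
  have "(\<lambda>i. l * (x(n := s)) i + (1 - l) * (y(n := t)) i)
      = (\<lambda>i. l * x i + (1 - l) * y i)(n := l * s + (1 - l) * t)"
    by auto
  from combination_le[of "x(n := s)" "y(n := t)", unfolded this]
  show "f (x(n := s)) powr l * g (y(n := t)) powr (1 - l)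
      \<le> h ((\<lambda>i. l * x i + (1 - l) * y i)(n := l * s + (1 - l) * t))" .
qed (use bounds measurable_compose[OF measurable_fun_upd_section] meas in auto)

lemma prekopa_leindler_cube:
  fixes f g h :: "(nat \<Rightarrow> real) \<Rightarrow> real"
  assumes "f \<in> borel_measurable borel" "g \<in> borel_measurable borel" "h \<in> borel_measurable borel"
    and "\<And>x. f x \<in> {0..B}" "\<And>x. g x \<in> {0..B}" "\<And>x. h x \<in> {0..B}"
    and l_bounds: "0 < l" "l < 1"
    and "\<And>x y. f x powr l * g y powr (1 - l) \<le> h (\<lambda>i. l * x i + (1 - l) * y i)"
  shows "(\<integral>x. f x \<partial>cube_measure n) powr l * (\<integral>x. g x \<partial>cube_measure n) powr (1 - l)
       \<le> (\<integral>x. h x \<partial>cube_measure n)"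
  using assms(1-6,9)
proof (induction n arbitrary: f g h)
  case 0
  have "(\<integral>x. u x \<partial>cube_measure 0) = u (\<lambda>_. 0)"
    if "u \<in> borel_measurable borel" for u :: "(nat \<Rightarrow> real) \<Rightarrow> real"
    unfolding cube_measure.simps using that by (intro integral_return) auto
  then show ?case using 0(7)[of "\<lambda>_. 0" "\<lambda>_. 0"] 0(1-3) by simp
next
  case (Suc n)
  let ?avg = "\<lambda>u x. \<integral>t. u (x(n := t)) \<partial>unif"
  have abs_le: "\<bar>u x\<bar> \<le> B" if "\<And>x. u x \<in> {0..B}" for u :: "(nat \<Rightarrow> real) \<Rightarrow> real" and x
    using that[of x] by auto
  have avg: "?avg u \<in> borel_measurable borel"
      "(\<integral>x. u x \<partial>cube_measure (Suc n)) = (\<integral>x. ?avg u x \<partial>cube_measure n)"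
    if "u \<in> borel_measurable borel" "\<And>x. u x \<in> {0..B}" for u :: "(nat \<Rightarrow> real) \<Rightarrow> real"
    by (intro borel_measurable_integral_fun_upd[where B = B] integral_cube_measure_Suc[where B = B]
        abs_le that)+
  have "(\<integral>x. ?avg f x \<partial>cube_measure n) powr l * (\<integral>x. ?avg g x \<partial>cube_measure n) powr (1 - l)
      \<le> (\<integral>x. ?avg h x \<partial>cube_measure n)"
    by (rule Suc.IH)
       (intro avg(1) integral_fun_upd_bounds prekopa_leindler_unif_section[where B = B]
          l_bounds Suc.prems)+
  then show ?case using avg(2) Suc.prems by simp
qed

lemma distr_cube_measure_coordinate:
  "distr (cube_measure n) borel (\<lambda>x. x i) = (if i < n then unif else return borel 0)"
proof (induction n)
  case 0
  show ?case by (simp add: distr_return)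
next
  case (Suc n)
  interpret pair_prob_space "cube_measure n" unif ..
  have "distr (cube_measure (Suc n)) borel (\<lambda>x. x i)
      = distr (cube_measure n \<Otimes>\<^sub>M unif) borel ((\<lambda>x. x i) \<circ> (\<lambda>(x, t). x(n := t)))"
    unfolding cube_measure.simps by (intro distr_distr) measurable
  also have "\<dots> = (if i < Suc n then unif else return borel 0)"
  proof (cases "i = n")
    case True
    have "distr (cube_measure n \<Otimes>\<^sub>M unif) borel snd = unif"
    proof (rule measure_eqI)
      fix A assume "A \<in> sets (distr (cube_measure n \<Otimes>\<^sub>M unif) borel snd)"
      moreover have "snd -` A \<inter> space (cube_measure n \<Otimes>\<^sub>M unif) = UNIV \<times> A"
        by (auto simp: space_pair_measure)
      ultimately show "emeasure (distr (cube_measure n \<Otimes>\<^sub>M unif) borel snd) A = emeasure unif A"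
        using cube.emeasure_space_1
        by (simp add: emeasure_distr unif.emeasure_pair_measure_Times)
    qed simp
    then show ?thesis using True by (simp add: comp_def case_prod_beta)
  next
    case False
    have "distr (cube_measure n \<Otimes>\<^sub>M unif) borel ((\<lambda>x. x i) \<circ> fst)
        = distr (distr (cube_measure n \<Otimes>\<^sub>M unif) (cube_measure n) fst) borel (\<lambda>x. x i)"
      by (intro distr_distr[symmetric]) measurable
    then show ?thesis
      using False Suc.IH by (simp add: comp_def case_prod_beta unif.distr_pair_fst)
  qed
  finally show ?case .
qed

lemma barycenter_origin_cube: "barycenter_origin n (cube_measure n)"
  unfolding barycenter_origin_def
proof (intro allI impI conjI)
  fix i assume "i < n"
  then have marginal: "distr (cube_measure n) borel (\<lambda>x. x i) = unif"
    by (simp add: distr_cube_measure_coordinate)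
  have coord: "(\<lambda>x. x i) \<in> cube_measure n \<rightarrow>\<^sub>M borel" by measurable
  have "integrable (distr (cube_measure n) borel (\<lambda>x. x i)) (\<lambda>t. t)"
    unfolding marginal by (rule integrable_unif_ident)
  then show "integrable (cube_measure n) (\<lambda>x. x i)"
    by (rule integrable_distr[OF coord])
  have "(\<integral>t. t \<partial>distr (cube_measure n) borel (\<lambda>x. x i)) = (\<integral>x. x i \<partial>cube_measure n)"
    by (rule integral_distr[OF coord]) (rule measurable_ident_sets[OF refl])
  then show "(\<integral>x. x i \<partial>cube_measure n) = 0"
    unfolding marginal by (simp only: integral_unif_ident)
qed

lemma measure_cube_measure_Rn: "measure (cube_measure n) (Rn n) = 1"
proof -
  have "AE x in cube_measure n. x i = 0" if "n \<le> i" for i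
  proof -
    have "distr (cube_measure n) borel (\<lambda>x. x i) = return borel 0"
      using that by (simp add: distr_cube_measure_coordinate)
    then have "AE t in distr (cube_measure n) borel (\<lambda>x. x i). t = 0"
      by (simp only:) (subst AE_return, auto)
    then show ?thesis by (subst (asm) AE_distr_iff) auto
  qed
  then have "AE x in cube_measure n. \<forall>i. n \<le> i \<longrightarrow> x i = 0"
    by (simp add: AE_all_countable)
  then show ?thesis
    by (intro cube.prob_eq_1[THEN iffD2]) (auto simp: Rn_def)
qed

lemma AE_cube_measure_inner_Rn_neq:
  assumes "\<exists>i<n. a i \<noteq> 0"
  shows "AE x in cube_measure n. inner_Rn n a x \<noteq> c"
  using assms
proof (induction n)
  case (Suc n)
  have inner_upd: "inner_Rn (Suc n) a (x(n := t)) = inner_Rn n a x + a n * t" for x t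
    by (simp add: inner_Rn_def)
  have "AE x in cube_measure n. AE t in unif. inner_Rn (Suc n) a (x(n := t)) \<noteq> c"
  proof (cases "a n = 0")
    case True
    then have "\<exists>i<n. a i \<noteq> 0" using Suc.prems less_Suc_eq by auto
    then show ?thesis using Suc.IH True by (auto simp: inner_upd elim: eventually_mono)
  next
    case False
    have "AE t in unif. inner_Rn n a x + a n * t \<noteq> c" for x
      using AE_unif_neq[of "(c - inner_Rn n a x) / a n"] False
      by (auto simp: field_simps elim!: eventually_mono)
    then show ?thesis by (simp add: inner_upd)
  qed
  then show ?case by (intro AE_cube_measure_Suc) measurable
qed simp

lemma log_concave_prob_cube: "log_concave_prob n (cube_measure n)"
  unfolding log_concave_prob_def
proof (intro conjI allI impI)
  fix A B and l :: real
  assume compacts: "compact A \<and> compact B \<and> A \<subseteq> Rn n \<and> B \<subseteq> Rn n \<and> 0 < l \<and> l < 1"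
  have [measurable]: "A \<in> sets borel" "B \<in> sets borel" "minkowski_comb l A B \<in> sets borel"
    using compacts by (auto intro!: borel_compact compact_minkowski_comb)
  have "(\<integral>x. indicator A x \<partial>cube_measure n) powr l * (\<integral>x. indicator B x \<partial>cube_measure n) powr (1 - l)
      \<le> (\<integral>x. indicator (minkowski_comb l A B) x \<partial>cube_measure n)"
  proof (rule prekopa_leindler_cube[where B = 1])
    fix x y
    have "(\<lambda>i. l * x i + (1 - l) * y i) \<in> minkowski_comb l A B" if "x \<in> A" "y \<in> B"
      using that by (auto simp: minkowski_comb_def)
    then show "indicator A x powr l * indicator B y powr (1 - l)
        \<le> (indicator (minkowski_comb l A B) (\<lambda>i. l * x i + (1 - l) * y i) :: real)"
      using compacts by (auto split: split_indicator)
  qed (use compacts in \<open>auto split: split_indicator\<close>)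
  then show "measure (cube_measure n) A powr l * measure (cube_measure n) B powr (1 - l)
      \<le> measure (cube_measure n) (minkowski_comb l A B)" by simp
next
  fix a :: "nat \<Rightarrow> real" and c assume "\<exists>i<n. a i \<noteq> 0"
  from AE_cube_measure_inner_Rn_neq[OF this, of c]
  have "AE x in cube_measure n. x \<notin> hyperplane_Rn n a c"
    by (auto simp: hyperplane_Rn_eq elim: eventually_mono)
  then show "measure (cube_measure n) (hyperplane_Rn n a c) < 1"
    by (subst cube.prob_eq_0[THEN iffD2]) auto
qed (auto simp: cube.prob_space_axioms measure_cube_measure_Rn)

subsection \<open>Moments of linear functionals under a log-concave measure\<close>

lemma sums_Suc_square_half_power: "(\<lambda>k. (real k + 1)\<^sup>2 * (1 / 2) ^ k) sums 12"
proof -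
  have "(\<Sum>k<m. (real k + 1)\<^sup>2 * (1 / 2) ^ k) = 12 - (2 * (real m)\<^sup>2 + 8 * real m + 12) * (1 / 2) ^ m" for m
  proof (induction m)
    case (Suc m)
    show ?case unfolding sum.lessThan_Suc Suc.IH by (simp add: field_simps power2_eq_square)
  qed simp
  moreover have "(\<lambda>m. 12 - (2 * (real m)\<^sup>2 + 8 * real m + 12) * (1 / 2) ^ m) \<longlonglongrightarrow> (12 :: real)"
    by real_asymp
  ultimately show ?thesis by (simp add: sums_def)
qed

lemma integrable_mult_of_square_integrable:
  fixes f g :: "'a \<Rightarrow> real"
  assumes [measurable]: "f \<in> borel_measurable M" "g \<in> borel_measurable M"
    and "integrable M (\<lambda>x. (f x)\<^sup>2)" "integrable M (\<lambda>x. (g x)\<^sup>2)"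
  shows "integrable M (\<lambda>x. f x * g x)"
proof (rule Bochner_Integration.integrable_bound)
  show "integrable M (\<lambda>x. (f x)\<^sup>2 + (g x)\<^sup>2)" using assms by simp
  have "\<bar>u * v\<bar> \<le> u\<^sup>2 + v\<^sup>2" for u v :: real
  proof -
    have "\<bar>u * v\<bar> \<le> 2 * \<bar>u\<bar> * \<bar>v\<bar>" by (simp add: abs_mult)
    also have "\<dots> \<le> u\<^sup>2 + v\<^sup>2" using sum_squares_bound[of "\<bar>u\<bar>" "\<bar>v\<bar>"] by simp
    finally show ?thesis .
  qed
  then show "AE x in M. norm (f x * g x) \<le> norm ((f x)\<^sup>2 + (g x)\<^sup>2)"
    by (auto intro!: AE_I2)
qed measurable

context prob_space
begin

lemma nn_integral_square_le_tail_sum: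
  fixes f :: "'a \<Rightarrow> real"
  assumes [measurable]: "f \<in> borel_measurable M" and s_pos: "0 < s"
  shows "(\<integral>\<^sup>+x. ennreal ((f x)\<^sup>2) \<partial>M)
    \<le> (\<Sum>k. ennreal ((s * (real k + 1))\<^sup>2 * prob {x \<in> space M. s * real k \<le> \<bar>f x\<bar>}))"
proof -
  let ?T = "\<lambda>k :: nat. {x \<in> space M. s * real k \<le> \<bar>f x\<bar>}"
  let ?g = "\<lambda>k x. ennreal ((s * (real k + 1))\<^sup>2) * indicator (?T k) x"
  have "(\<integral>\<^sup>+x. ennreal ((f x)\<^sup>2) \<partial>M) \<le> (\<integral>\<^sup>+x. (\<Sum>k. ?g k x) \<partial>M)"
  proof (rule nn_integral_mono)
    fix x assume x_space: "x \<in> space M"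
    define k where "k = nat \<lfloor>\<bar>f x\<bar> / s\<rfloor>"
    have "real k \<le> \<bar>f x\<bar> / s" "\<bar>f x\<bar> / s \<le> real k + 1"
      using s_pos by (auto simp: k_def of_nat_nat)
    then have k_floor: "s * real k \<le> \<bar>f x\<bar>" "\<bar>f x\<bar> \<le> s * (real k + 1)"
      using s_pos by (simp_all add: field_simps)
    have "(f x)\<^sup>2 \<le> (s * (real k + 1))\<^sup>2"
      using power_mono[OF k_floor(2), of 2] by simp
    then have "ennreal ((f x)\<^sup>2) \<le> ?g k x"
      using k_floor(1) x_space by (simp add: ennreal_leI)
    also have "\<dots> \<le> (\<Sum>j. ?g j x)"
    proof -
      have "u k \<le> (\<Sum>j. u j)" for u :: "nat \<Rightarrow> ennreal"
        using sum_le_suminf[of u "{k}"] by simp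
      then show ?thesis .
    qed
    finally show "ennreal ((f x)\<^sup>2) \<le> (\<Sum>j. ?g j x)" .
  qed
  also have "\<dots> = (\<Sum>k. \<integral>\<^sup>+x. ?g k x \<partial>M)"
    by (intro nn_integral_suminf) measurable
  also have "\<dots> = (\<Sum>k. ennreal ((s * (real k + 1))\<^sup>2 * prob (?T k)))"
    by (simp add: nn_integral_cmult_indicator emeasure_eq_measure ennreal_mult)
  finally show ?thesis .
qed

lemma
  fixes f :: "'a \<Rightarrow> real"
  assumes f [measurable]: "f \<in> borel_measurable M" and s_pos: "0 < s" and c_nonneg: "0 \<le> c"
    and tail: "\<And>k :: nat. prob {x \<in> space M. s * real k \<le> \<bar>f x\<bar>} \<le> c * (1 / 2) ^ k"
  shows square_integrable_of_exponential_tail: "integrable M (\<lambda>x. (f x)\<^sup>2)"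
    and second_moment_le_of_exponential_tail: "expectation (\<lambda>x. (f x)\<^sup>2) \<le> 12 * c * s\<^sup>2"
proof -
  have "(\<integral>\<^sup>+x. ennreal ((f x)\<^sup>2) \<partial>M)
      \<le> (\<Sum>k. ennreal ((s * (real k + 1))\<^sup>2 * prob {x \<in> space M. s * real k \<le> \<bar>f x\<bar>}))"
    by (rule nn_integral_square_le_tail_sum[OF f s_pos])
  also have "\<dots> \<le> (\<Sum>k. ennreal (c * s\<^sup>2 * ((real k + 1)\<^sup>2 * (1 / 2) ^ k)))"
  proof (intro suminf_le ennreal_leI)
    fix k
    show "(s * (real k + 1))\<^sup>2 * prob {x \<in> space M. s * real k \<le> \<bar>f x\<bar>}
        \<le> c * s\<^sup>2 * ((real k + 1)\<^sup>2 * (1 / 2) ^ k)"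
      using mult_left_mono[OF tail[of k], of "(s * (real k + 1))\<^sup>2"]
      by (simp add: power_mult_distrib mult_ac)
  qed auto
  also have "\<dots> = ennreal (12 * c * s\<^sup>2)"
    using sums_mult[OF sums_Suc_square_half_power, of "c * s\<^sup>2"] c_nonneg
    by (intro suminf_ennreal_eq) (auto simp: mult_ac)
  finally have bound: "(\<integral>\<^sup>+x. ennreal ((f x)\<^sup>2) \<partial>M) \<le> ennreal (12 * c * s\<^sup>2)" .
  then show "integrable M (\<lambda>x. (f x)\<^sup>2)"
    by (intro integrableI_bounded) (auto simp: le_less_trans)
  then show "expectation (\<lambda>x. (f x)\<^sup>2) \<le> 12 * c * s\<^sup>2"
    using bound c_nonneg by (simp add: nn_integral_eq_integral)
qed

text \<open>Integrate \<open>\<bar>f\<bar> + f \<le> k / 4 + (k / 4) f\<^sup>2 + (4 / k) 1\<^bsub>{f \<ge> k / 8}\<^esub>\<close>.\<close>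

lemma prob_ge_of_mean_zero_variance_one:
  fixes f :: "'a \<Rightarrow> real"
  assumes integrable: "integrable M f" "integrable M (\<lambda>x. (f x)\<^sup>2)"
    and mean: "expectation f = 0" and variance: "expectation (\<lambda>x. (f x)\<^sup>2) = 1"
    and k_bounds: "0 < k" "k \<le> expectation (\<lambda>x. \<bar>f x\<bar>)"
  shows "k\<^sup>2 / 8 \<le> prob {x \<in> space M. k / 8 \<le> f x}"
proof -
  let ?P = "{x \<in> space M. k / 8 \<le> f x}"
  have [measurable]: "f \<in> borel_measurable M" using integrable(1) by simp
  have int_P: "integrable M (indicator ?P :: 'a \<Rightarrow> real)"
    by (simp add: emeasure_eq_measure)
  have "expectation (\<lambda>x. \<bar>f x\<bar>) = expectation (\<lambda>x. \<bar>f x\<bar> + f x)"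
    using integrable mean by simp
  also have "\<dots> \<le> expectation (\<lambda>x. k / 4 + (k / 4) * (f x)\<^sup>2 + (4 / k) * indicator ?P x)"
  proof (rule integral_mono)
    fix x assume x_space: "x \<in> space M"
    show "\<bar>f x\<bar> + f x \<le> k / 4 + (k / 4) * (f x)\<^sup>2 + (4 / k) * indicator ?P x"
    proof (cases "k / 8 \<le> f x")
      case True
      have "0 \<le> (k / 4) * (f x - 4 / k)\<^sup>2" using k_bounds by simp
      also have "\<dots> = (k / 4) * (f x)\<^sup>2 - 2 * f x + 4 / k"
        using k_bounds(1) by (simp add: power2_eq_square field_simps)
      finally show ?thesis using True k_bounds x_space by simp
    next
      case False
      then have "\<bar>f x\<bar> + f x \<le> k / 4" using k_bounds(1) by (auto simp: abs_if)
      also have "\<dots> \<le> k / 4 + (k / 4) * (f x)\<^sup>2" using k_bounds by simp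
      finally show ?thesis using False by simp
    qed
  qed (use integrable int_P in auto)
  also have "\<dots> = k / 4 + k / 4 + (4 / k) * prob ?P"
    using integrable int_P variance by (simp add: prob_space)
  finally have "k / 2 \<le> (4 / k) * prob ?P" using k_bounds by simp
  then show ?thesis using k_bounds by (simp add: field_simps power2_eq_square)
qed

end

lemma minkowski_comb_half_space_slab_subset:
  assumes l_bounds: "0 < l" "l < 1"
  shows "minkowski_comb l {x. t \<le> inner_Rn n a x} {x. \<bar>inner_Rn n a x\<bar> \<le> w}
    \<subseteq> {x. l * t - (1 - l) * w \<le> inner_Rn n a x}"
proof
  fix z assume "z \<in> minkowski_comb l {x. t \<le> inner_Rn n a x} {x. \<bar>inner_Rn n a x\<bar> \<le> w}"
  then obtain x y where z: "z = (\<lambda>i. l * x i + (1 - l) * y i)"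
    and xy_bounds: "t \<le> inner_Rn n a x" "\<bar>inner_Rn n a y\<bar> \<le> w"
    by (auto simp: minkowski_comb_def)
  have "l * t + (1 - l) * (- w) \<le> l * inner_Rn n a x + (1 - l) * inner_Rn n a y"
    using xy_bounds l_bounds by (intro add_mono mult_left_mono) auto
  also have "\<dots> = inner_Rn n a z" by (simp add: z inner_Rn_right_linear)
  finally show "z \<in> {x. l * t - (1 - l) * w \<le> inner_Rn n a x}" by simp
qed

locale log_concave =
  fixes n :: nat and \<mu> :: "(nat \<Rightarrow> real) measure"
  assumes log_concave_prob: "log_concave_prob n \<mu>"
begin

sublocale prob_space \<mu>
  using log_concave_prob by (simp add: log_concave_prob_def)

lemma sets_mu [simp, measurable_cong]: "sets \<mu> = sets borel"
  using log_concave_prob by (simp add: log_concave_prob_def)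

lemma space_mu [simp]: "space \<mu> = UNIV"
  using sets_eq_imp_space_eq[OF sets_mu] by simp

lemma prob_UNIV [simp]: "prob UNIV = 1"
  using prob_space by simp

lemma sets_Collect_mu [measurable (raw)]:
  assumes "Measurable.pred borel P"
  shows "{x. P x} \<in> sets \<mu>"
  using assms by (simp add: pred_def)

lemma prob_Rn: "prob (Rn n) = 1"
  using log_concave_prob by (simp add: log_concave_prob_def)

lemma AE_Rn: "AE x in \<mu>. x \<in> Rn n"
  using prob_Rn by (subst AE_in_set_eq_1) auto

lemma prob_Int_Rn:
  assumes [measurable]: "A \<in> sets borel"
  shows "prob (A \<inter> Rn n) = prob A"
  using AE_Rn by (intro finite_measure_eq_AE) (auto elim!: AE_mp)

lemma prob_Int_box_tendsto:
  assumes "closed F"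
  shows "(\<lambda>M. prob (F \<inter> box_Rn n (real M))) \<longlonglongrightarrow> prob F"
proof -
  let ?A = "\<lambda>M. F \<inter> box_Rn n (real M)"
  have F: "F \<in> sets borel" using assms by auto
  have "(\<lambda>M. prob (?A M)) \<longlonglongrightarrow> prob (\<Union>M. ?A M)"
  proof (rule finite_Lim_measure_incseq)
    have "?A M \<in> sets borel" for M
      using F borel_compact[OF compact_box_Rn[of n "real M"]] by (rule sets.Int)
    then show "range ?A \<subseteq> events" by auto
    show "incseq ?A" by (force simp: incseq_def box_Rn_def)
  qed
  also have "(\<Union>M. ?A M) = F \<inter> Rn n"
  proof (intro equalityI subsetI)
    fix x assume x: "x \<in> F \<inter> Rn n"
    obtain M where "(\<Sum>i<n. \<bar>x i\<bar>) \<le> real M" using real_arch_simple by blast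
    moreover have "\<bar>x i\<bar> \<le> (\<Sum>i<n. \<bar>x i\<bar>)" if "i < n" for i
      using that by (intro member_le_sum) auto
    ultimately have "x \<in> ?A M" using x by (force simp: box_Rn_def)
    then show "x \<in> (\<Union>M. ?A M)" by blast
  qed (auto simp: box_Rn_def)
  finally show ?thesis using F by (simp add: prob_Int_Rn)
qed

lemma prob_powr_mult_le_closed:
  assumes closed: "closed A" "closed B" and C: "C \<in> sets borel" and l_bounds: "0 < l" "l < 1"
    and combination_in: "minkowski_comb l A B \<subseteq> C"
  shows "prob A powr l * prob B powr (1 - l) \<le> prob C"
proof (rule LIMSEQ_le_const2)
  let ?cut = "\<lambda>F M. F \<inter> box_Rn n (real M)"
  show "(\<lambda>M. prob (?cut A M) powr l * prob (?cut B M) powr (1 - l))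
      \<longlonglongrightarrow> prob A powr l * prob B powr (1 - l)"
    using l_bounds
    by (intro tendsto_mult tendsto_powr' prob_Int_box_tendsto closed tendsto_const) auto
  have "prob (?cut A M) powr l * prob (?cut B M) powr (1 - l) \<le> prob C" for M
  proof -
    have "compact (?cut A M)" "compact (?cut B M)" "?cut A M \<subseteq> Rn n" "?cut B M \<subseteq> Rn n"
      using closed compact_box_Rn by (auto intro!: closed_Int_compact simp: box_Rn_def)
    then have "prob (?cut A M) powr l * prob (?cut B M) powr (1 - l)
        \<le> prob (minkowski_comb l (?cut A M) (?cut B M))"
      using log_concave_prob l_bounds unfolding log_concave_prob_def by blast
    also have "\<dots> \<le> prob C"
      using combination_in C by (intro finite_measure_mono) (auto simp: minkowski_comb_def)
    finally show ?thesis .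
  qed
  then show "\<exists>M0. \<forall>M\<ge>M0. prob (?cut A M) powr l * prob (?cut B M) powr (1 - l) \<le> prob C" by blast
qed

text \<open>Borell's lemma: a point beyond \<open>t e\<close> and a point of the slab of width \<open>3 e\<close> average to a
  point beyond \<open>3 e\<close>, where Markov's inequality leaves mass at most 1/3.\<close>

lemma prob_inner_Rn_ge_le:
  assumes integrable: "integrable \<mu> (inner_Rn n a)"
    and e_bounds: "0 < e" "expectation (\<lambda>x. \<bar>inner_Rn n a x\<bar>) \<le> e"
    and t_gt_3: "3 < t"
  shows "prob {x. t * e \<le> inner_Rn n a x} \<le> (1 / 2) powr ((t + 3) / 6)"
proof -
  define l where "l = 6 / (t + 3)"
  have l_bounds: "0 < l" "l < 1" "l * (t + 3) = 6"
    using t_gt_3 by (simp_all add: l_def divide_eq_eq)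
  let ?far = "{x. t * e \<le> inner_Rn n a x}" and ?slab = "{x. \<bar>inner_Rn n a x\<bar> \<le> 3 * e}"
  let ?outside = "{x. 3 * e \<le> \<bar>inner_Rn n a x\<bar>}"
  have "prob {x \<in> space \<mu>. 3 * e \<le> \<bar>inner_Rn n a x\<bar>} \<le> expectation (\<lambda>x. \<bar>inner_Rn n a x\<bar>) / (3 * e)"
    using integrable e_bounds by (intro integral_Markov_inequality_measure[where A = "{}"]) auto
  also have "\<dots> \<le> 1 / 3" using e_bounds by (simp add: field_simps)
  finally have markov: "prob ?outside \<le> 1 / 3" by simp
  have "?slab \<union> ?outside = UNIV" by auto
  then have "1 = prob (?slab \<union> ?outside)" by simp
  also have "\<dots> \<le> prob ?slab + prob ?outside" by (intro measure_Un_le) measurable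
  finally have slab: "2 / 3 \<le> prob ?slab" using markov by simp
  have "l * (t * e) - (1 - l) * (3 * e) = (l * (t + 3) - 3) * e" by (simp add: algebra_simps)
  then have "l * (t * e) - (1 - l) * (3 * e) = 3 * e" by (simp add: l_bounds(3))
  then have "minkowski_comb l ?far ?slab \<subseteq> ?outside"
    using minkowski_comb_half_space_slab_subset[OF l_bounds(1,2), of "t * e" n a "3 * e"] by force
  then have "prob ?far powr l * prob ?slab powr (1 - l) \<le> prob ?outside"
    using l_bounds by (intro prob_powr_mult_le_closed closed_Collect_le continuous_intros) auto
  moreover have "prob ?far powr l * (2 / 3) \<le> prob ?far powr l * prob ?slab powr (1 - l)"
  proof (rule mult_left_mono)
    have "2 / 3 \<le> (2 / 3 :: real) powr (1 - l)"
      using l_bounds powr_mono'[of "1 - l" 1 "2 / 3"] by simp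
    also have "\<dots> \<le> prob ?slab powr (1 - l)" using slab l_bounds by (intro powr_mono2) auto
    finally show "2 / 3 \<le> prob ?slab powr (1 - l)" .
  qed simp
  ultimately have "prob ?far powr l \<le> 1 / 2" using markov by simp
  then have "(prob ?far powr l) powr (1 / l) \<le> (1 / 2) powr (1 / l)"
    using l_bounds by (intro powr_mono2) auto
  moreover have "(prob ?far powr l) powr (1 / l) = prob ?far"
    using l_bounds by (simp add: powr_powr)
  moreover have "1 / l = (t + 3) / 6" by (simp add: l_def)
  ultimately show ?thesis by simp
qed

lemma prob_abs_inner_Rn_ge_le:
  assumes integrable: "integrable \<mu> (inner_Rn n a)"
    and e_bounds: "0 < e" "expectation (\<lambda>x. \<bar>inner_Rn n a x\<bar>) \<le> e"
  shows "prob {x. (6 * e) * real k \<le> \<bar>inner_Rn n a x\<bar>} \<le> 2 * (1 / 2) ^ k"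
proof (cases "k = 0")
  case True
  then show ?thesis using prob_le_1[of UNIV] by simp
next
  case False
  have half: "prob {x. (6 * e) * real k \<le> inner_Rn n b x} \<le> (1 / 2) ^ k"
    if "integrable \<mu> (inner_Rn n b)" "expectation (\<lambda>x. \<bar>inner_Rn n b x\<bar>) \<le> e" for b
  proof -
    have "prob {x. (6 * real k) * e \<le> inner_Rn n b x} \<le> (1 / 2) powr ((6 * real k + 3) / 6)"
      using False that e_bounds by (intro prob_inner_Rn_ge_le) auto
    also have "\<dots> \<le> (1 / 2) powr real k" by (intro powr_mono') auto
    finally show ?thesis by (simp add: powr_realpow mult_ac)
  qed
  let ?neg = "\<lambda>i. - a i"
  have inner_Rn_neg: "inner_Rn n ?neg = (\<lambda>x. - inner_Rn n a x)"
    by (simp add: inner_Rn_left_linear fun_eq_iff)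
  have "prob {x. (6 * e) * real k \<le> \<bar>inner_Rn n a x\<bar>}
      \<le> prob ({x. (6 * e) * real k \<le> inner_Rn n a x} \<union> {x. (6 * e) * real k \<le> inner_Rn n ?neg x})"
    by (intro finite_measure_mono) (auto simp: inner_Rn_neg intro!: sets_Collect_mu sets.Un)
  also have "\<dots> \<le> prob {x. (6 * e) * real k \<le> inner_Rn n a x}
      + prob {x. (6 * e) * real k \<le> inner_Rn n ?neg x}"
    by (intro measure_Un_le sets_Collect_mu) measurable
  also have "\<dots> \<le> (1 / 2) ^ k + (1 / 2) ^ k"
    using integrable e_bounds by (intro add_mono half) (simp_all add: inner_Rn_neg)
  finally show ?thesis by simp
qed

lemma
  assumes integrable: "integrable \<mu> (inner_Rn n a)"
  shows square_integrable_inner_Rn: "integrable \<mu> (\<lambda>x. (inner_Rn n a x)\<^sup>2)"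
    and second_moment_inner_Rn_le:
      "expectation (\<lambda>x. (inner_Rn n a x)\<^sup>2) \<le> (30 * expectation (\<lambda>x. \<bar>inner_Rn n a x\<bar>))\<^sup>2"
proof -
  define e where "e = expectation (\<lambda>x. \<bar>inner_Rn n a x\<bar>)"
  have "integrable \<mu> (\<lambda>x. (inner_Rn n a x)\<^sup>2) \<and> expectation (\<lambda>x. (inner_Rn n a x)\<^sup>2) \<le> (30 * e)\<^sup>2"
  proof (cases "e = 0")
    case True
    then have "AE x in \<mu>. inner_Rn n a x = 0"
      unfolding e_def using integrable by (subst (asm) integral_nonneg_eq_0_iff_AE) auto
    then have zero: "AE x in \<mu>. (inner_Rn n a x)\<^sup>2 = 0" by (auto elim: eventually_mono)
    then have "integrable \<mu> (\<lambda>x. (inner_Rn n a x)\<^sup>2)"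
      by (subst integrable_cong_AE[where g = "\<lambda>_. 0"]) auto
    then show ?thesis using integral_eq_zero_AE[OF zero] by simp
  next
    case False
    have "0 \<le> e" unfolding e_def by (intro integral_nonneg_AE) auto
    with False have e_pos: "0 < e" by simp
    have tail: "prob {x \<in> space \<mu>. (6 * e) * real k \<le> \<bar>inner_Rn n a x\<bar>} \<le> 2 * (1 / 2) ^ k" for k
      using prob_abs_inner_Rn_ge_le[OF integrable e_pos, of k] by (simp add: e_def)
    have "expectation (\<lambda>x. (inner_Rn n a x)\<^sup>2) \<le> 12 * 2 * (6 * e)\<^sup>2"
      using e_pos by (intro second_moment_le_of_exponential_tail tail) auto
    also have "\<dots> \<le> (30 * e)\<^sup>2" by (simp add: power2_eq_square)
    finally have "expectation (\<lambda>x. (inner_Rn n a x)\<^sup>2) \<le> (30 * e)\<^sup>2" .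
    moreover have "integrable \<mu> (\<lambda>x. (inner_Rn n a x)\<^sup>2)"
      using e_pos by (intro square_integrable_of_exponential_tail[OF _ _ _ tail]) auto
    ultimately show ?thesis by simp
  qed
  then show "integrable \<mu> (\<lambda>x. (inner_Rn n a x)\<^sup>2)"
    "expectation (\<lambda>x. (inner_Rn n a x)\<^sup>2) \<le> (30 * expectation (\<lambda>x. \<bar>inner_Rn n a x\<bar>))\<^sup>2"
    by (simp_all add: e_def)
qed

lemma prob_centered_half_space_ge:
  assumes integrable: "integrable \<mu> (inner_Rn n a)" and mean: "expectation (inner_Rn n a) = 0"
    and variance: "expectation (\<lambda>x. (inner_Rn n a x)\<^sup>2) = 1"
  shows "1 / 7200 \<le> prob {x. 1 / 240 \<le> inner_Rn n a x}"
proof -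
  have "1\<^sup>2 \<le> (30 * expectation (\<lambda>x. \<bar>inner_Rn n a x\<bar>))\<^sup>2"
    using second_moment_inner_Rn_le[OF integrable] unfolding variance power_one .
  then have "1 \<le> 30 * expectation (\<lambda>x. \<bar>inner_Rn n a x\<bar>)"
    by (rule power2_le_imp_le) (simp add: integral_nonneg_AE)
  then have "1 / 30 \<le> expectation (\<lambda>x. \<bar>inner_Rn n a x\<bar>)" by simp
  then have "(1 / 30)\<^sup>2 / 8 \<le> prob {x \<in> space \<mu>. 1 / 30 / 8 \<le> inner_Rn n a x}"
    by (intro prob_ge_of_mean_zero_variance_one integrable square_integrable_inner_Rn mean variance)
       simp_all
  then show ?thesis by (simp add: power2_eq_square)
qed

lemma second_moment_inner_Rn_pos:
  assumes integrable: "integrable \<mu> (inner_Rn n a)" and a_nonzero: "\<exists>i<n. a i \<noteq> 0"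
  shows "0 < expectation (\<lambda>x. (inner_Rn n a x)\<^sup>2)"
proof (rule ccontr)
  assume "\<not> 0 < expectation (\<lambda>x. (inner_Rn n a x)\<^sup>2)"
  moreover have "0 \<le> expectation (\<lambda>x. (inner_Rn n a x)\<^sup>2)" by (intro integral_nonneg_AE) auto
  ultimately have "AE x in \<mu>. (inner_Rn n a x)\<^sup>2 = 0"
    using square_integrable_inner_Rn[OF integrable]
    by (subst integral_nonneg_eq_0_iff_AE[symmetric]) auto
  with AE_Rn have "AE x in \<mu>. x \<in> hyperplane_Rn n a 0"
    by eventually_elim (simp add: hyperplane_Rn_eq)
  then have "prob (hyperplane_Rn n a 0) = 1"
    by (subst (asm) AE_in_set_eq_1) auto
  moreover have "prob (hyperplane_Rn n a 0) < 1"
    using log_concave_prob a_nonzero by (simp add: log_concave_prob_def)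
  ultimately show False by simp
qed

end

subsection \<open>Isotropic coordinates\<close>

locale positive_definite_form =
  fixes n :: nat and B :: "(nat \<Rightarrow> real) \<Rightarrow> (nat \<Rightarrow> real) \<Rightarrow> real"
  assumes form_commute: "B a b = B b a"
    and form_add_scale: "B (\<lambda>i. a i + r * b i) c = B a c + r * B b c"
    and form_pos: "\<exists>i<n. a i \<noteq> 0 \<Longrightarrow> 0 < B a a"
begin

lemma form_scale: "B (\<lambda>i. r * a i) c = r * B a c"
proof -
  have "B (\<lambda>_. 0) c = 0" using form_add_scale[of "\<lambda>_. 0" 1 "\<lambda>_. 0" c] by simp
  then show ?thesis using form_add_scale[of "\<lambda>_. 0" r a c] by simp
qed

lemma form_sum:
  assumes "finite J"
  shows "B (\<lambda>i. \<Sum>j\<in>J. c j * u j i) b = (\<Sum>j\<in>J. c j * B (u j) b)"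
  using assms
proof (induction J)
  case empty
  then show ?case using form_scale[of 0 "\<lambda>_. 0" b] by simp
next
  case (insert j J)
  then show ?case
    using form_add_scale[of "\<lambda>i. \<Sum>j\<in>J. c j * u j i" "c j" "u j" b] by (simp add: add.commute)
qed

definition orthonormal :: "(nat \<Rightarrow> nat \<Rightarrow> real) \<Rightarrow> nat \<Rightarrow> bool" where
  "orthonormal u k \<longleftrightarrow> (\<forall>i<k. \<forall>j<k. B (u i) (u j) = of_bool (i = j))"

lemma form_sum_orthonormal:
  assumes "orthonormal u k" "j < k"
  shows "B (\<lambda>i. \<Sum>j<k. c j * u j i) (u j) = c j"
proof -
  have "(\<Sum>i<k. c i * B (u i) (u j)) = (\<Sum>i<k. if i = j then c i else 0)"
    using assms by (intro sum.cong) (auto simp: orthonormal_def)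
  then show ?thesis using assms(2) by (simp add: form_sum)
qed

lemma parseval:
  assumes "orthonormal u k"
  shows "B (\<lambda>i. \<Sum>j<k. c j * u j i) (\<lambda>i. \<Sum>j<k. c j * u j i) = (\<Sum>j<k. (c j)\<^sup>2)"
proof -
  let ?v = "\<lambda>i. \<Sum>j<k. c j * u j i"
  have "B ?v ?v = (\<Sum>j<k. c j * B (u j) ?v)" by (simp add: form_sum)
  also have "\<dots> = (\<Sum>j<k. (c j)\<^sup>2)"
    using form_sum_orthonormal[OF assms]
    by (intro sum.cong) (auto simp: form_commute power2_eq_square)
  finally show ?thesis .
qed

lemma orthonormal_extend:
  assumes k_less: "k < n" and orthonormal: "orthonormal u k"
    and supp: "\<And>j i. j < k \<Longrightarrow> k \<le> i \<Longrightarrow> u j i = 0"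
  obtains w where "orthonormal (u(k := w)) (Suc k)" "w k \<noteq> 0" "\<forall>i>k. w i = 0"
proof -
  define e where "e i = (if i = k then 1 else 0 :: real)" for i
  define v where "v = (\<lambda>i. e i + (-1) * (\<Sum>j<k. B e (u j) * u j i))"
  define w where "w = (\<lambda>i. (1 / sqrt (B v v)) * v i)"
  have v_support: "v k = 1" "\<And>i. k < i \<Longrightarrow> v i = 0" using supp by (simp_all add: v_def e_def)
  then have v_pos: "0 < B v v" using k_less by (intro form_pos) auto
  have v_orth: "B v (u j) = 0" if "j < k" for j
    unfolding v_def form_add_scale using form_sum_orthonormal[OF orthonormal that] by simp
  have w_form: "B w b = B v b / sqrt (B v v)" for b
    unfolding w_def form_scale by simp
  have w_orth: "B w (u j) = 0" "B (u j) w = 0" if "j < k" for j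
    using w_form[of "u j"] v_orth[OF that] form_commute[of "u j" w] by auto
  have "B w w = B v v / (sqrt (B v v) * sqrt (B v v))"
    using w_form[of w] w_form[of v] form_commute[of v w] by simp
  then have "B w w = 1" using v_pos by simp
  with w_orth orthonormal have "orthonormal (u(k := w)) (Suc k)"
    unfolding orthonormal_def by (auto simp: less_Suc_eq)
  moreover have "w k \<noteq> 0" "\<forall>i>k. w i = 0" using v_support v_pos by (auto simp: w_def)
  ultimately show thesis by (rule that)
qed

theorem gram_schmidt:
  assumes "k \<le> n"
  obtains u where "orthonormal u k" "\<And>j i. j < k \<Longrightarrow> k \<le> i \<Longrightarrow> u j i = 0"
    and "\<And>a. (\<And>i. k \<le> i \<Longrightarrow> a i = 0) \<Longrightarrow> \<exists>c. a = (\<lambda>i. \<Sum>j<k. c j * u j i)"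
  using assms
proof (induction k arbitrary: thesis)
  case 0
  show ?case by (rule 0(1)[of "\<lambda>_ _. 0"]) (auto simp: orthonormal_def)
next
  case (Suc k)
  show ?case
  proof (rule Suc.IH)
    fix u assume orthonormal: "orthonormal u k" and supp: "\<And>j i. j < k \<Longrightarrow> k \<le> i \<Longrightarrow> u j i = 0"
      and span: "\<And>a. (\<And>i. k \<le> i \<Longrightarrow> a i = 0) \<Longrightarrow> \<exists>c. a = (\<lambda>i. \<Sum>j<k. c j * u j i)"
    have "k < n" using Suc.prems(2) by simp
    obtain w where
      w_extends: "orthonormal (u(k := w)) (Suc k)" "w k \<noteq> 0" "\<forall>i>k. w i = 0"
      using orthonormal_extend[OF \<open>k < n\<close> orthonormal supp] .
    show thesis
    proof (rule Suc.prems(1)[OF w_extends(1)])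
      show "(u(k := w)) j i = 0" if "j < Suc k" "Suc k \<le> i" for j i
        using that supp w_extends(3) by (auto simp: less_Suc_eq)
      fix a :: "nat \<Rightarrow> real" assume a_support: "\<And>i. Suc k \<le> i \<Longrightarrow> a i = 0"
      define r where "r = a k / w k"
      have "\<exists>c. (\<lambda>i. a i - r * w i) = (\<lambda>i. \<Sum>j<k. c j * u j i)"
      proof (rule span)
        fix i assume "k \<le> i"
        then show "a i - r * w i = 0"
          using a_support w_extends(2,3) by (cases "i = k") (auto simp: r_def)
      qed
      then obtain c where c_coordinates: "(\<lambda>i. a i - r * w i) = (\<lambda>i. \<Sum>j<k. c j * u j i)" ..
      have "a i = (\<Sum>j<k. c j * u j i) + r * w i" for i
        using fun_cong[OF c_coordinates, of i] by linarith
      then have "a = (\<lambda>i. \<Sum>j<Suc k. (c(k := r)) j * (u(k := w)) j i)"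
        by (intro ext) simp
      then show "\<exists>c. a = (\<lambda>i. \<Sum>j<Suc k. c j * (u(k := w)) j i)" by blast
    qed
  qed (use Suc.prems(2) in simp)
qed

end

locale centered_log_concave = log_concave +
  assumes barycenter: "barycenter_origin n \<mu>"
begin

lemma integrable_inner_Rn: "integrable \<mu> (inner_Rn n a)"
  and expectation_inner_Rn: "expectation (inner_Rn n a) = 0"
  using barycenter unfolding inner_Rn_def barycenter_origin_def by auto

lemma integrable_inner_Rn_mult: "integrable \<mu> (\<lambda>x. inner_Rn n a x * inner_Rn n b x)"
  by (intro integrable_mult_of_square_integrable square_integrable_inner_Rn integrable_inner_Rn) auto

sublocale covariance: positive_definite_form n "\<lambda>a b. expectation (\<lambda>x. inner_Rn n a x * inner_Rn n b x)"
proof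
  fix a b c :: "nat \<Rightarrow> real" and r
  show "expectation (\<lambda>x. inner_Rn n a x * inner_Rn n b x)
      = expectation (\<lambda>x. inner_Rn n b x * inner_Rn n a x)"
    by (simp add: mult.commute)
  show "expectation (\<lambda>x. inner_Rn n (\<lambda>i. a i + r * b i) x * inner_Rn n c x)
      = expectation (\<lambda>x. inner_Rn n a x * inner_Rn n c x)
        + r * expectation (\<lambda>x. inner_Rn n b x * inner_Rn n c x)"
    using integrable_inner_Rn_mult by (simp add: inner_Rn_left_linear distrib_right mult.assoc)
  show "0 < expectation (\<lambda>x. inner_Rn n a x * inner_Rn n a x)" if "\<exists>i<n. a i \<noteq> 0"
    using second_moment_inner_Rn_pos[OF integrable_inner_Rn that] by (simp add: power2_eq_square)
qed

end

locale isotropic_frame = centered_log_concave +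
  fixes u :: "nat \<Rightarrow> nat \<Rightarrow> real"
  assumes orthonormal: "covariance.orthonormal u n"
    and spanning: "a \<in> Rn n \<Longrightarrow> \<exists>c. a = (\<lambda>i. \<Sum>j<n. c j * u j i)"

lemma (in centered_log_concave) isotropic_frame_exists:
  obtains u where "isotropic_frame n \<mu> u"
proof (rule covariance.gram_schmidt[OF order_refl])
  fix u assume "covariance.orthonormal u n"
    and "\<And>a. (\<And>i. n \<le> i \<Longrightarrow> a i = 0) \<Longrightarrow> \<exists>c. a = (\<lambda>i. \<Sum>j<n. c j * u j i)"
  then have "isotropic_frame n \<mu> u"
    by unfold_locales (auto simp: Rn_def)
  then show thesis by (rule that)
qed

context isotropic_frame
begin

definition coordinate_form :: "(nat \<Rightarrow> real) \<Rightarrow> (nat \<Rightarrow> real) \<Rightarrow> real" where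
  "coordinate_form c x = inner_Rn n (\<lambda>i. \<Sum>j<n. c j * u j i) x"

definition frame_norm :: "(nat \<Rightarrow> real) \<Rightarrow> real" where
  "frame_norm x = (\<Sum>j<n. \<bar>inner_Rn n (u j) x\<bar>)"

lemma coordinate_form_eq_sum: "coordinate_form c x = (\<Sum>j<n. c j * inner_Rn n (u j) x)"
  by (simp add: coordinate_form_def inner_Rn_left_linear)

lemma borel_measurable_coordinate_form [measurable]: "coordinate_form c \<in> borel_measurable borel"
  unfolding coordinate_form_eq_sum[abs_def] by measurable

lemma borel_measurable_frame_norm [measurable]: "frame_norm \<in> borel_measurable borel"
  unfolding frame_norm_def[abs_def] by measurable

lemma coordinate_form_scale: "coordinate_form (\<lambda>j. r * c j) x = r * coordinate_form c x"
  by (simp add: coordinate_form_eq_sum sum_distrib_left mult.assoc)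

lemma inner_Rn_eq_coordinate_form:
  obtains c where "inner_Rn n a = coordinate_form c"
proof -
  define a' where "a' i = (if i < n then a i else 0)" for i
  have "a' \<in> Rn n" by (simp add: Rn_def a'_def)
  from spanning[OF this] obtain c where "a' = (\<lambda>i. \<Sum>j<n. c j * u j i)" ..
  moreover have "inner_Rn n a x = inner_Rn n a' x" for x
    by (simp add: inner_Rn_def a'_def)
  ultimately have "inner_Rn n a = coordinate_form c" by (simp add: coordinate_form_def[abs_def] ext)
  then show thesis by (rule that)
qed

lemma second_moment_coordinate_form: "expectation (\<lambda>x. (coordinate_form c x)\<^sup>2) = (\<Sum>j<n. (c j)\<^sup>2)"
  using covariance.parseval[OF orthonormal, of c]
  by (simp add: coordinate_form_def power2_eq_square)

lemma prob_coordinate_form_ge: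
  assumes "(\<Sum>j<n. (c j)\<^sup>2) = 1"
  shows "1 / 7200 \<le> prob {x. 1 / 240 \<le> coordinate_form c x}"
  using prob_centered_half_space_ge[OF integrable_inner_Rn expectation_inner_Rn,
      of "\<lambda>i. \<Sum>j<n. c j * u j i"]
    second_moment_coordinate_form[of c] assms
  by (simp add: coordinate_form_def)

lemma coordinate_form_diff_le:
  assumes "\<And>j. j < n \<Longrightarrow> \<bar>b j - c j\<bar> \<le> \<epsilon>"
  shows "\<bar>coordinate_form b x - coordinate_form c x\<bar> \<le> \<epsilon> * frame_norm x"
proof -
  have "\<bar>coordinate_form b x - coordinate_form c x\<bar> = \<bar>\<Sum>j<n. (b j - c j) * inner_Rn n (u j) x\<bar>"
    by (simp add: coordinate_form_eq_sum sum_subtractf left_diff_distrib)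
  also have "\<dots> \<le> (\<Sum>j<n. \<bar>b j - c j\<bar> * \<bar>inner_Rn n (u j) x\<bar>)"
    by (rule order_trans[OF sum_abs]) (simp add: abs_mult)
  also have "\<dots> \<le> (\<Sum>j<n. \<epsilon> * \<bar>inner_Rn n (u j) x\<bar>)"
    using assms by (intro sum_mono mult_right_mono) auto
  finally show ?thesis by (simp add: frame_norm_def sum_distrib_left)
qed

lemma prob_frame_norm_ge_le:
  assumes "0 < R"
  shows "prob {x. R \<le> frame_norm x} \<le> real n / R"
proof -
  have abs_moment: "expectation (\<lambda>x. \<bar>inner_Rn n (u j) x\<bar>) \<le> 1" if "j < n" for j
  proof -
    have variance: "expectation (\<lambda>x. (inner_Rn n (u j) x)\<^sup>2) = 1"
      using orthonormal that by (simp add: covariance.orthonormal_def power2_eq_square)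
    have "expectation (\<lambda>x. \<bar>inner_Rn n (u j) x\<bar>) \<le> expectation (\<lambda>x. (1 + (inner_Rn n (u j) x)\<^sup>2) / 2)"
    proof (rule integral_mono)
      fix x
      show "\<bar>inner_Rn n (u j) x\<bar> \<le> (1 + (inner_Rn n (u j) x)\<^sup>2) / 2"
        using sum_squares_bound[of 1 "\<bar>inner_Rn n (u j) x\<bar>"] by simp
    qed (use integrable_inner_Rn square_integrable_inner_Rn[OF integrable_inner_Rn] in auto)
    also have "\<dots> = 1"
      using square_integrable_inner_Rn[OF integrable_inner_Rn, of "u j"] variance by simp
    finally show ?thesis .
  qed
  have integrable: "integrable \<mu> frame_norm"
    unfolding frame_norm_def[abs_def] using integrable_inner_Rn by auto
  have "prob {x \<in> space \<mu>. R \<le> frame_norm x} \<le> expectation frame_norm / R"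
  proof (rule integral_Markov_inequality_measure[where A = "{}"])
    show "AE x in \<mu>. 0 \<le> frame_norm x" by (auto simp: frame_norm_def intro!: sum_nonneg)
  qed (use integrable assms in auto)
  also have "expectation frame_norm = (\<Sum>j<n. expectation (\<lambda>x. \<bar>inner_Rn n (u j) x\<bar>))"
    unfolding frame_norm_def[abs_def] using integrable_inner_Rn
    by (intro Bochner_Integration.integral_sum) auto
  also have "\<dots> \<le> (\<Sum>j<n. 1)" using abs_moment by (intro sum_mono) auto
  finally show ?thesis using assms by (simp add: divide_right_mono)
qed

end

subsection \<open>Upper quantiles\<close>

context prob_space
begin

definition upper_quantile :: "real \<Rightarrow> ('a \<Rightarrow> real) \<Rightarrow> real" where
  "upper_quantile q Z = Sup {s. q \<le> prob {x \<in> space M. s \<le> Z x}}"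

lemma prob_ge_antimono:
  fixes Z :: "'a \<Rightarrow> real"
  assumes "Z \<in> borel_measurable M" "s \<le> t"
  shows "prob {x \<in> space M. t \<le> Z x} \<le> prob {x \<in> space M. s \<le> Z x}"
  using assms by (intro finite_measure_mono) auto

lemma
  fixes Z :: "'a \<Rightarrow> real"
  assumes Z [measurable]: "Z \<in> borel_measurable M"
  shows prob_ge_at_left:
      "((\<lambda>s. prob {x \<in> space M. s \<le> Z x}) \<longlongrightarrow> prob {x \<in> space M. t \<le> Z x}) (at_left t)"
    and prob_ge_at_right:
      "((\<lambda>s. prob {x \<in> space M. s \<le> Z x}) \<longlongrightarrow> prob {x \<in> space M. t < Z x}) (at_right t)"
    and prob_ge_at_top:
      "((\<lambda>s. prob {x \<in> space M. s \<le> Z x}) \<longlongrightarrow> 0) at_top"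
    and prob_ge_at_bot:
      "((\<lambda>s. prob {x \<in> space M. s \<le> Z x}) \<longlongrightarrow> 1) at_bot"
proof -
  let ?D = "distr M borel (\<lambda>x. - Z x)"
  interpret D: real_distribution ?D by (rule real_distribution_distr) measurable
  have cdf: "cdf ?D (- s) = prob {x \<in> space M. s \<le> Z x}" for s
    by (simp add: cdf_def measure_distr vimage_def Int_def conj_commute)
  have less: "measure ?D {..<- s} = prob {x \<in> space M. s < Z x}" for s
    by (simp add: measure_distr vimage_def Int_def conj_commute)
  have "((\<lambda>r. cdf ?D r) \<longlongrightarrow> cdf ?D (- t)) (at_right (- t))"
    using D.cdf_is_right_cont[of "- t"] by (simp add: continuous_within)
  then show "((\<lambda>s. prob {x \<in> space M. s \<le> Z x}) \<longlongrightarrow> prob {x \<in> space M. t \<le> Z x}) (at_left t)"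
    unfolding at_right_minus filterlim_filtermap cdf by simp
  have "((\<lambda>r. cdf ?D r) \<longlongrightarrow> measure ?D {..<- t}) (at_left (- t))"
    by (rule D.cdf_at_left)
  then show "((\<lambda>s. prob {x \<in> space M. s \<le> Z x}) \<longlongrightarrow> prob {x \<in> space M. t < Z x}) (at_right t)"
    unfolding at_left_minus filterlim_filtermap cdf less by simp
  show "((\<lambda>s. prob {x \<in> space M. s \<le> Z x}) \<longlongrightarrow> 0) at_top"
    using filterlim_compose[OF D.cdf_lim_at_bot filterlim_uminus_at_bot_at_top] by (simp add: cdf)
  show "((\<lambda>s. prob {x \<in> space M. s \<le> Z x}) \<longlongrightarrow> 1) at_bot"
    using filterlim_compose[OF D.cdf_lim_at_top_prob filterlim_uminus_at_top_at_bot]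
    by (simp add: cdf)
qed

lemma bdd_above_quantile_set:
  fixes Z :: "'a \<Rightarrow> real"
  assumes Z: "Z \<in> borel_measurable M" and q: "0 < q"
  shows "bdd_above {s. q \<le> prob {x \<in> space M. s \<le> Z x}}"
proof -
  from order_tendstoD(2)[OF prob_ge_at_top[OF Z] q]
  obtain t where prob_t_less: "prob {x \<in> space M. t \<le> Z x} < q"
    by (auto simp: eventually_at_top_linorder)
  show ?thesis
  proof (rule bdd_aboveI)
    fix s assume "s \<in> {s. q \<le> prob {x \<in> space M. s \<le> Z x}}"
    then show "s \<le> t" using prob_ge_antimono[OF Z, of t s] prob_t_less by force
  qed
qed

lemma le_upper_quantile:
  fixes Z :: "'a \<Rightarrow> real"
  assumes "Z \<in> borel_measurable M" "0 < q" "q \<le> prob {x \<in> space M. s \<le> Z x}"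
  shows "s \<le> upper_quantile q Z"
  unfolding upper_quantile_def using assms by (intro cSup_upper bdd_above_quantile_set) auto

lemma prob_ge_upper_quantile:
  fixes Z :: "'a \<Rightarrow> real"
  assumes Z: "Z \<in> borel_measurable M" and q: "0 < q" "q < 1"
  shows "q \<le> prob {x \<in> space M. upper_quantile q Z \<le> Z x}"
proof (rule tendsto_lowerbound[OF prob_ge_at_left[OF Z]])
  let ?S = "{s. q \<le> prob {x \<in> space M. s \<le> Z x}}"
  from order_tendstoD(1)[OF prob_ge_at_bot[OF Z] q(2)]
  obtain s where "q < prob {x \<in> space M. s \<le> Z x}"
    by (auto simp: eventually_at_bot_linorder)
  then have "?S \<noteq> {}" by (auto intro: less_imp_le)
  have "q \<le> prob {x \<in> space M. s \<le> Z x}" if less: "s < upper_quantile q Z" for s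
  proof -
    obtain t where "t \<in> ?S" "s < t"
      using less_cSupD[OF \<open>?S \<noteq> {}\<close> less[unfolded upper_quantile_def]] by blast
    then show ?thesis using prob_ge_antimono[OF Z, of s t] by simp
  qed
  then show "\<forall>\<^sub>F s in at_left (upper_quantile q Z). q \<le> prob {x \<in> space M. s \<le> Z x}"
    using eventually_at_left_real[of "upper_quantile q Z - 1" "upper_quantile q Z"]
    by (auto elim: eventually_mono)
qed simp

lemma prob_gt_upper_quantile:
  fixes Z :: "'a \<Rightarrow> real"
  assumes Z: "Z \<in> borel_measurable M" and q: "0 < q"
  shows "prob {x \<in> space M. upper_quantile q Z < Z x} \<le> q"
proof (rule tendsto_upperbound[OF prob_ge_at_right[OF Z]])
  have "prob {x \<in> space M. s \<le> Z x} \<le> q" if "upper_quantile q Z < s" for s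
    using le_upper_quantile[OF Z q, of s] that by force
  then show "\<forall>\<^sub>F s in at_right (upper_quantile q Z). prob {x \<in> space M. s \<le> Z x} \<le> q"
    using eventually_at_right_real[of "upper_quantile q Z" "upper_quantile q Z + 1"]
    by (auto elim: eventually_mono)
qed simp

subsection \<open>Independent samples\<close>

abbreviation sample_measure :: "nat \<Rightarrow> (nat \<Rightarrow> 'a) measure" where
  "sample_measure N \<equiv> PiM {..<N} (\<lambda>_. M)"

lemma prob_space_sample_measure: "prob_space (sample_measure N)"
  by (intro prob_space_PiM prob_space_axioms)

lemma
  assumes A: "A \<in> events"
  shows sets_samples_all_in: "{X \<in> space (sample_measure N). \<forall>j<N. X j \<in> A} \<in> sets (sample_measure N)"
    and measure_samples_all_in:
      "measure (sample_measure N) {X \<in> space (sample_measure N). \<forall>j<N. X j \<in> A} = prob A ^ N"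
proof -
  let ?P = "sample_measure N"
  interpret P: product_prob_space "\<lambda>_. M" "{..<N}" ..
  have all_eq: "{X \<in> space ?P. \<forall>j<N. X j \<in> A} = {X \<in> space ?P. \<forall>j\<in>{..<N}. X j \<in> A}" by auto
  show "{X \<in> space ?P. \<forall>j<N. X j \<in> A} \<in> sets ?P"
    unfolding all_eq using A by (intro sets.sets_Collect_finite_All sets_Collect_single') auto
  have "emeasure ?P {X \<in> space ?P. \<forall>j<N. X j \<in> A} = (\<Prod>j\<in>{..<N}. emeasure M A)"
    unfolding all_eq using A by (intro P.emeasure_PiM_Collect) auto
  also have "\<dots> = ennreal (prob A ^ N)"
    by (simp add: emeasure_eq_measure ennreal_power)
  finally show "measure ?P {X \<in> space ?P. \<forall>j<N. X j \<in> A} = prob A ^ N" by (simp add: measure_def)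
qed

definition hitting_samples :: "nat \<Rightarrow> 'a set \<Rightarrow> 'a set set \<Rightarrow> (nat \<Rightarrow> 'a) set" where
  "hitting_samples N A \<E> =
    {X \<in> space (sample_measure N). (\<forall>j<N. X j \<in> A) \<and> (\<forall>E\<in>\<E>. \<exists>j<N. X j \<in> E)}"

definition missing_samples :: "nat \<Rightarrow> 'a set \<Rightarrow> (nat \<Rightarrow> 'a) set" where
  "missing_samples N E = {X \<in> space (sample_measure N). \<forall>j<N. X j \<in> space M - E}"

lemma hitting_samples_eq:
  "hitting_samples N A \<E> = {X \<in> space (sample_measure N). \<forall>j<N. X j \<in> A}
    - (\<Union>E\<in>\<E>. missing_samples N E)"
proof -
  have "X j \<in> space M" if "X \<in> space (sample_measure N)" "j < N" for X j
    using that by (auto simp: space_PiM)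
  then show ?thesis unfolding hitting_samples_def missing_samples_def by blast
qed

lemma sets_missing_samples:
  assumes "E \<in> events"
  shows "missing_samples N E \<in> sets (sample_measure N)"
  unfolding missing_samples_def using assms by (intro sets_samples_all_in) auto

lemma measure_missing_samples:
  assumes "E \<in> events"
  shows "measure (sample_measure N) (missing_samples N E) = (1 - prob E) ^ N"
  unfolding missing_samples_def using assms
  by (simp add: measure_samples_all_in prob_compl del: Diff_iff)

lemma sets_hitting_samples:
  assumes "finite \<E>" "\<E> \<subseteq> events" "A \<in> events"
  shows "hitting_samples N A \<E> \<in> sets (sample_measure N)"
  unfolding hitting_samples_eq using assms
  by (intro sets.Diff sets.finite_UN sets_samples_all_in sets_missing_samples) auto

lemma measure_Union_missing_samples_le:
  assumes \<E>: "finite \<E>" "\<E> \<subseteq> events" and q: "\<And>E. E \<in> \<E> \<Longrightarrow> q \<le> prob E"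
  shows "measure (sample_measure N) (\<Union>E\<in>\<E>. missing_samples N E) \<le> real (card \<E>) * (1 - q) ^ N"
proof -
  interpret sample: prob_space "sample_measure N" by (rule prob_space_sample_measure)
  have "sample.prob (missing_samples N E) \<le> (1 - q) ^ N" if "E \<in> \<E>" for E
  proof -
    have "E \<in> events" using \<E>(2) that by blast
    then show ?thesis
      using q[OF that] by (simp add: measure_missing_samples power_mono)
  qed
  then have "(\<Sum>E\<in>\<E>. sample.prob (missing_samples N E)) \<le> real (card \<E>) * (1 - q) ^ N"
    by (rule sum_bounded_above)
  moreover have "sample.prob (\<Union>E\<in>\<E>. missing_samples N E) \<le> (\<Sum>E\<in>\<E>. sample.prob (missing_samples N E))"
    using \<E> by (intro sample.finite_measure_subadditive_finite) (auto intro: sets_missing_samples)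
  ultimately show ?thesis by linarith
qed

lemma measure_hitting_samples_ge:
  assumes \<E>: "finite \<E>" "\<E> \<subseteq> events" and A: "A \<in> events" "prob A = 1"
    and q: "\<And>E. E \<in> \<E> \<Longrightarrow> q \<le> prob E"
  shows "1 - real (card \<E>) * (1 - q) ^ N \<le> measure (sample_measure N) (hitting_samples N A \<E>)"
proof -
  interpret sample: prob_space "sample_measure N" by (rule prob_space_sample_measure)
  let ?all = "{X \<in> space (sample_measure N). \<forall>j<N. X j \<in> A}"
  let ?missing = "\<Union>E\<in>\<E>. missing_samples N E"
  have "?missing \<in> sample.events"
    using \<E> by (intro sets.finite_UN sets_missing_samples) auto
  note events = sets_hitting_samples[OF \<E> A(1), of N] this
  have "1 = sample.prob ?all" unfolding measure_samples_all_in[OF A(1)] A(2) by simp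
  also have "\<dots> \<le> sample.prob (hitting_samples N A \<E> \<union> ?missing)"
  proof (rule sample.finite_measure_mono)
    show "?all \<subseteq> hitting_samples N A \<E> \<union> ?missing" unfolding hitting_samples_eq by blast
  qed (rule sets.Un[OF events])
  also have "\<dots> \<le> sample.prob (hitting_samples N A \<E>) + sample.prob ?missing"
    using events by (rule measure_Un_le)
  finally show ?thesis using measure_Union_missing_samples_le[OF \<E> q, of N] by linarith
qed

end

subsection \<open>Convex hulls of finitely many points\<close>

lemma closed_projection_compact:
  fixes K :: "'a::topological_space set" and T :: "('a \<times> 'b::topological_space) set"
  assumes K: "compact K" and T: "closed T"
  shows "closed {y. \<exists>x\<in>K. (x, y) \<in> T}"
proof -
  have "prod_topology (top_of_set K) (euclidean :: 'b topology) = top_of_set (K \<times> UNIV)"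
    using prod_topology_subtopology(1)[of euclidean K euclidean] by simp
  then have "closedin (prod_topology (top_of_set K) euclidean) ((K \<times> UNIV) \<inter> T)"
    using T by (simp add: closedin_closed_Int)
  moreover have "closed_map (prod_topology (top_of_set K) (euclidean :: 'b topology)) euclidean snd"
    using K
    by (intro Abstract_Topological_Spaces.closed_map_snd) (simp add: compact_space_subtopology)
  ultimately have "closed (snd ` ((K \<times> UNIV) \<inter> T))"
    unfolding closed_map_def closed_closedin by blast
  also have "snd ` ((K \<times> UNIV) \<inter> T) = {y. \<exists>x\<in>K. (x, y) \<in> T}" by force
  finally show ?thesis .
qed

definition simplex_weights :: "nat \<Rightarrow> (nat \<Rightarrow> real) set" where
  "simplex_weights N = {w \<in> Rn N. (\<forall>j<N. 0 \<le> w j) \<and> (\<Sum>j<N. w j) = 1}"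

lemma compact_simplex_weights: "compact (simplex_weights N)"
proof -
  have "\<bar>w i\<bar> \<le> 1" if "\<forall>j<N. 0 \<le> w j" "(\<Sum>j<N. w j) = 1" "i < N" for w :: "nat \<Rightarrow> real" and i
    using that member_le_sum[of i "{..<N}" w] by simp
  then have "simplex_weights N = box_Rn N 1
      \<inter> ((\<Inter>j\<in>{..<N}. {w. 0 \<le> w j}) \<inter> {w. (\<Sum>j<N. w j) = 1})"
    by (auto simp: simplex_weights_def box_Rn_def)
  also have "compact \<dots>"
    by (intro compact_Int_closed compact_box_Rn closed_Int closed_INT ballI closed_Collect_le closed_Collect_eq
        continuous_intros continuous_on_product_coordinates)
  finally show ?thesis .
qed

lemma vertex_in_simplex_weights: "j < N \<Longrightarrow> (\<lambda>k. of_bool (k = j)) \<in> simplex_weights N"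
  by (simp add: simplex_weights_def Rn_def of_bool_def)

lemma scaled_hull_eq:
  "scaled_hull t N X = (\<lambda>w i. t * (\<Sum>j<N. w j * X j i)) ` simplex_weights N"
proof (intro equalityI subsetI)
  fix y assume "y \<in> scaled_hull t N X"
  then obtain w where w: "y = (\<lambda>i. t * (\<Sum>j<N. w j * X j i))" "\<forall>j<N. 0 \<le> w j" "(\<Sum>j<N. w j) = 1"
    by (auto simp: scaled_hull_def)
  let ?w = "\<lambda>j. if j < N then w j else 0"
  have "?w \<in> simplex_weights N" using w by (simp add: simplex_weights_def Rn_def)
  moreover have "y = (\<lambda>i. t * (\<Sum>j<N. ?w j * X j i))" using w by simp
  ultimately show "y \<in> (\<lambda>w i. t * (\<Sum>j<N. w j * X j i)) ` simplex_weights N"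
    by (rule image_eqI[where x = ?w, rotated])
qed (auto simp: scaled_hull_def simplex_weights_def)

lemma scaled_hull_cong:
  assumes "\<And>j. j < N \<Longrightarrow> X j = Y j"
  shows "scaled_hull t N X = scaled_hull t N Y"
  using assms unfolding scaled_hull_def by simp

lemma compact_scaled_hull: "compact (scaled_hull t N X)"
proof -
  have "continuous_on (simplex_weights N) (\<lambda>w i. t * (\<Sum>j<N. w j * X j i))"
    by (intro continuous_on_coordinatewise_then_product continuous_intros
        continuous_on_subset[OF continuous_on_product_coordinates]) auto
  then show ?thesis
    unfolding scaled_hull_eq by (intro compact_continuous_image compact_simplex_weights)
qed

lemma scaled_hull_subset_Rn:
  assumes "\<And>j. j < N \<Longrightarrow> X j \<in> Rn n"
  shows "scaled_hull t N X \<subseteq> Rn n"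
  using assms by (auto simp: scaled_hull_def Rn_def)

lemma scaled_vertex_in_scaled_hull:
  assumes "j < N"
  shows "(\<lambda>i. t * X j i) \<in> scaled_hull t N X"
proof -
  have "(\<lambda>i. t * X j i) = (\<lambda>i. t * (\<Sum>k<N. of_bool (k = j) * X k i))"
    using assms by (simp add: of_bool_def if_distrib[of "\<lambda>r. r * _"] cong: if_cong)
  then show ?thesis
    unfolding scaled_hull_eq
    by (rule image_eqI[where x = "\<lambda>k. of_bool (k = j)"]) (rule vertex_in_simplex_weights[OF assms])
qed

lemma minkowski_comb_scaled_hull_subset:
  assumes "0 < l" "l < 1"
  shows "minkowski_comb l (scaled_hull t N X) (scaled_hull t N X) \<subseteq> scaled_hull t N X"
proof
  fix z assume "z \<in> minkowski_comb l (scaled_hull t N X) (scaled_hull t N X)"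
  then obtain v w where weights: "v \<in> simplex_weights N" "w \<in> simplex_weights N"
    and z: "z = (\<lambda>i. l * (t * (\<Sum>j<N. v j * X j i)) + (1 - l) * (t * (\<Sum>j<N. w j * X j i)))"
    unfolding scaled_hull_eq minkowski_comb_def by auto
  let ?w = "\<lambda>j. l * v j + (1 - l) * w j"
  have "?w \<in> simplex_weights N"
    using weights assms
    by (auto simp: simplex_weights_def Rn_def sum.distrib simp flip: sum_distrib_left)
  moreover have "z = (\<lambda>i. t * (\<Sum>j<N. ?w j * X j i))"
    unfolding z sum_distrib_left by (simp add: algebra_simps flip: sum.distrib)
  ultimately show "z \<in> scaled_hull t N X"
    unfolding scaled_hull_eq by (rule image_eqI[where x = ?w, rotated])
qed

lemma separating_functional_scaled_hull:
  assumes N: "0 < N" and x: "x \<in> Rn n" "x \<notin> scaled_hull t N X" and X: "\<And>j. j < N \<Longrightarrow> X j \<in> Rn n"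
  obtains a where "\<And>j. j < N \<Longrightarrow> t * inner_Rn n a (X j) < inner_Rn n a x"
proof (rule separating_functional_compact_convex)
  show "scaled_hull t N X \<noteq> {}" using scaled_vertex_in_scaled_hull[OF N] by blast
  show "scaled_hull t N X \<subseteq> Rn n" by (rule scaled_hull_subset_Rn[OF X])
  fix a assume sep: "\<And>y. y \<in> scaled_hull t N X \<Longrightarrow> inner_Rn n a y < inner_Rn n a x"
  show thesis
  proof (rule that)
    fix j assume "j < N"
    from sep[OF scaled_vertex_in_scaled_hull[OF this]]
    show "t * inner_Rn n a (X j) < inner_Rn n a x" by (simp add: inner_Rn_right_linear)
  qed
qed (use x compact_scaled_hull minkowski_comb_scaled_hull_subset in auto)

lemma closed_graph_scaled_hull:
  "closed {p :: (nat \<Rightarrow> nat \<Rightarrow> real) \<times> (nat \<Rightarrow> real). snd p \<in> scaled_hull t N (fst p)}"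
proof -
  let ?T = "{q :: (nat \<Rightarrow> real) \<times> (nat \<Rightarrow> nat \<Rightarrow> real) \<times> (nat \<Rightarrow> real).
      \<forall>i. snd (snd q) i = t * (\<Sum>j<N. fst q j * fst (snd q) j i)}"
  note coordinate = continuous_on_product_then_coordinatewise
  have weight: "continuous_on UNIV
      (\<lambda>q :: (nat \<Rightarrow> real) \<times> (nat \<Rightarrow> nat \<Rightarrow> real) \<times> (nat \<Rightarrow> real). fst q j)" for j
    by (rule coordinate) (intro continuous_intros)
  have point: "continuous_on UNIV
      (\<lambda>q :: (nat \<Rightarrow> real) \<times> (nat \<Rightarrow> nat \<Rightarrow> real) \<times> (nat \<Rightarrow> real). fst (snd q) j i)" for j i
    by (rule coordinate, rule coordinate) (intro continuous_intros)
  have image: "continuous_on UNIV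
      (\<lambda>q :: (nat \<Rightarrow> real) \<times> (nat \<Rightarrow> nat \<Rightarrow> real) \<times> (nat \<Rightarrow> real). snd (snd q) i)" for i
    by (rule coordinate) (intro continuous_intros)
  have "closed ?T"
    by (intro closed_Collect_all closed_Collect_eq continuous_on_mult continuous_on_const continuous_on_sum
        weight point image)
  moreover have "{p. \<exists>w\<in>simplex_weights N. (w, p) \<in> ?T} = {p. snd p \<in> scaled_hull t N (fst p)}"
    unfolding scaled_hull_eq by (auto simp: fun_eq_iff image_iff)
  ultimately show ?thesis
    using closed_projection_compact[OF compact_simplex_weights, of ?T N] by simp
qed

context log_concave
begin

lemma borel_measurable_measure_scaled_hull:
  "(\<lambda>X. prob (scaled_hull t N X)) \<in> borel_measurable (sample_measure N)"
proof -
  let ?P = "sample_measure N"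
  define extend :: "(nat \<Rightarrow> nat \<Rightarrow> real) \<Rightarrow> nat \<Rightarrow> nat \<Rightarrow> real" where
    "extend X j = (if j < N then X j else (\<lambda>_. 0))" for X j
  have "extend \<in> ?P \<rightarrow>\<^sub>M PiM UNIV (\<lambda>_. borel)"
  proof (rule measurable_PiM_single')
    fix j :: nat
    show "(\<lambda>X. extend X j) \<in> ?P \<rightarrow>\<^sub>M borel"
    proof (cases "j < N")
      case True
      then have "(\<lambda>X. X j) \<in> ?P \<rightarrow>\<^sub>M \<mu>"
        by (intro measurable_component_singleton) auto
      then show ?thesis using True unfolding extend_def by (simp cong: measurable_cong_sets)
    qed (simp add: extend_def)
  qed auto
  then have [measurable]: "extend \<in> borel_measurable ?P"
    by (simp add: measurable_cong_sets[OF refl sets_PiM_equal_borel])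
  have "(\<lambda>p. (extend (fst p), snd p)) \<in> (?P \<Otimes>\<^sub>M \<mu>) \<rightarrow>\<^sub>M (borel \<Otimes>\<^sub>M borel)"
    by measurable
  then have "(\<lambda>p. (extend (fst p), snd p)) -` {p. snd p \<in> scaled_hull t N (fst p)} \<inter> space (?P \<Otimes>\<^sub>M \<mu>)
      \<in> sets (?P \<Otimes>\<^sub>M \<mu>)"
    by (rule measurable_sets) (unfold borel_prod, intro borel_closed closed_graph_scaled_hull)
  moreover have "scaled_hull t N (extend X) = scaled_hull t N X" for X
    by (rule scaled_hull_cong) (simp add: extend_def)
  ultimately have "{p \<in> space (?P \<Otimes>\<^sub>M \<mu>). snd p \<in> scaled_hull t N (fst p)} \<in> sets (?P \<Otimes>\<^sub>M \<mu>)"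
    by (simp add: vimage_def Int_def conj_commute)
  from measurable_emeasure_Pair[OF this]
  have "(\<lambda>X. enn2real (emeasure \<mu> (Pair X -` {p \<in> space (?P \<Otimes>\<^sub>M \<mu>). snd p \<in> scaled_hull t N (fst p)})))
      \<in> borel_measurable ?P"
    by measurable
  then show ?thesis
    by (rule measurable_cong[THEN iffD1, rotated])
       (simp add: measure_def space_pair_measure vimage_def)
qed

interpretation sample: prob_space "sample_measure N" for N
  by (rule prob_space_sample_measure)

lemma integrable_measure_scaled_hull:
  "integrable (sample_measure N) (\<lambda>X. prob (scaled_hull t N X))"
  by (rule sample.integrable_const_bound[where B = 1])
     (auto simp: borel_measurable_measure_scaled_hull)

lemma expected_cover_le_1: "expected_cover \<mu> N d \<le> 1"
  unfolding expected_cover_def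
  by (intro sample.integral_le_const integrable_measure_scaled_hull) auto

lemma expected_cover_ge_mult:
  assumes \<Omega>: "\<Omega> \<in> sets (sample_measure N)"
    and cover: "\<And>X. X \<in> \<Omega> \<Longrightarrow> G \<subseteq> scaled_hull (1 + d) N X"
  shows "prob G * measure (sample_measure N) \<Omega> \<le> expected_cover \<mu> N d"
proof -
  let ?P = "sample_measure N"
  have "prob G * measure ?P \<Omega> = (\<integral>X. prob G * indicator \<Omega> X \<partial>?P)" using \<Omega> by simp
  also have "\<dots> \<le> (\<integral>X. prob (scaled_hull (1 + d) N X) \<partial>?P)"
  proof (rule integral_mono)
    show "integrable ?P (\<lambda>X. prob G * indicator \<Omega> X)"
      using \<Omega> by (auto simp: sample.emeasure_eq_measure)
    fix X
    have "prob G \<le> prob (scaled_hull (1 + d) N X)" if "X \<in> \<Omega>"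
      using cover[OF that]
      by (rule finite_measure_mono) (simp add: borel_compact compact_scaled_hull)
    then show "prob G * indicator \<Omega> X \<le> prob (scaled_hull (1 + d) N X)"
      by (auto split: split_indicator)
  qed (rule integrable_measure_scaled_hull)
  finally show ?thesis by (simp add: expected_cover_def)
qed

end

lemma expected_cover_nonneg: "0 \<le> expected_cover \<mu> N d"
  unfolding expected_cover_def by (intro integral_nonneg_AE) auto

subsection \<open>A grid of directions\<close>

definition direction_grid :: "nat \<Rightarrow> nat \<Rightarrow> (nat \<Rightarrow> real) set" where
  "direction_grid n m = PiE {..<n} (\<lambda>_. (\<lambda>k. of_int k / real m) ` {- int m..int m})"

lemma finite_direction_grid: "finite (direction_grid n m)"
  unfolding direction_grid_def by (intro finite_PiE) auto

lemma card_direction_grid_le: "real (card (direction_grid n m)) \<le> (2 * real m + 1) ^ n"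
proof -
  have "card ((\<lambda>k. of_int k / real m) ` {- int m..int m}) \<le> card {- int m..int m}"
    by (rule card_image_le) simp
  then have "card (direction_grid n m) \<le> (2 * m + 1) ^ n"
    unfolding direction_grid_def by (simp add: card_PiE power_mono)
  then have "real (card (direction_grid n m)) \<le> real ((2 * m + 1) ^ n)" by (rule of_nat_mono)
  then show ?thesis by (simp add: add.commute)
qed

lemma direction_grid_approximates:
  assumes m_pos: "0 < m" and e_unit: "(\<Sum>j<n. (e j)\<^sup>2) = 1"
  shows "\<exists>b\<in>direction_grid n m. \<forall>j<n. \<bar>b j - e j\<bar> \<le> 1 / real m"
proof (intro bexI allI impI)
  define k where "k j = \<lfloor>real m * e j\<rfloor>" for j
  let ?b = "\<lambda>j\<in>{..<n}. of_int (k j) / real m"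
  have floor: "of_int (k j) \<le> real m * e j" "real m * e j < of_int (k j) + 1" for j
    unfolding k_def by linarith+
  have "k j \<in> {- int m..int m}" if "j < n" for j
  proof -
    have "(e j)\<^sup>2 \<le> (\<Sum>j<n. (e j)\<^sup>2)" using that by (intro member_le_sum) auto
    then have "\<bar>e j\<bar> \<le> 1" using e_unit abs_le_square_iff[of "e j" 1] by simp
    then have "- 1 \<le> e j" "e j \<le> 1" by auto
    then have "real m * (- 1) \<le> real m * e j" "real m * e j \<le> real m * 1"
      by (intro mult_left_mono; simp)+
    with floor[of j] have "of_int (k j) \<le> real m" "- real m < of_int (k j) + 1" by linarith+
    then show ?thesis by auto
  qed
  then show "?b \<in> direction_grid n m" unfolding direction_grid_def by auto
  fix j assume "j < n"
  have "of_int (k j) / real m - e j = (of_int (k j) - real m * e j) / real m"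
    using m_pos by (simp add: diff_divide_distrib)
  then have "\<bar>of_int (k j) / real m - e j\<bar> = \<bar>of_int (k j) - real m * e j\<bar> / real m" by simp
  also have "\<dots> \<le> 1 / real m" using floor[of j] by (intro divide_right_mono) auto
  finally show "\<bar>?b j - e j\<bar> \<le> 1 / real m" using \<open>j < n\<close> by simp
qed

subsection \<open>Covering by a random polytope\<close>

context isotropic_frame
begin

definition truncated_form :: "real \<Rightarrow> (nat \<Rightarrow> real) \<Rightarrow> (nat \<Rightarrow> real) \<Rightarrow> real" where
  "truncated_form R c x = (if frame_norm x \<le> R then coordinate_form c x else 0)"

lemma borel_measurable_truncated_form [measurable]: "truncated_form R c \<in> borel_measurable borel"
  unfolding truncated_form_def[abs_def] by measurable

lemma quantile_truncated_form_ge: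
  assumes e_unit: "(\<Sum>j<n. (e j)\<^sup>2) = 1" and near: "\<And>j. j < n \<Longrightarrow> \<bar>b j - e j\<bar> \<le> \<epsilon>"
    and \<epsilon>: "0 \<le> \<epsilon>" "\<epsilon> * R \<le> 1 / 480" and R_pos: "0 < R"
    and q_bounds: "0 < q" "real n / R + q \<le> 1 / 7200"
  shows "1 / 480 \<le> upper_quantile q (truncated_form R b)"
proof (rule le_upper_quantile)
  have "{x. 1 / 240 \<le> coordinate_form e x}
      \<subseteq> {x. 1 / 480 \<le> truncated_form R b x} \<union> {x. R \<le> frame_norm x}"
  proof
    fix x assume x_cap: "x \<in> {x. 1 / 240 \<le> coordinate_form e x}"
    have "\<bar>coordinate_form b x - coordinate_form e x\<bar> \<le> \<epsilon> * frame_norm x"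
      by (rule coordinate_form_diff_le[OF near])
    moreover have "\<epsilon> * frame_norm x \<le> \<epsilon> * R" if "frame_norm x \<le> R"
      using that \<epsilon>(1) by (rule mult_left_mono)
    ultimately show "x \<in> {x. 1 / 480 \<le> truncated_form R b x} \<union> {x. R \<le> frame_norm x}"
      using x_cap \<epsilon>(2) by (auto simp: truncated_form_def)
  qed
  then have "prob {x. 1 / 240 \<le> coordinate_form e x}
      \<le> prob ({x. 1 / 480 \<le> truncated_form R b x} \<union> {x. R \<le> frame_norm x})"
    by (rule finite_measure_mono) measurable
  also have "\<dots> \<le> prob {x. 1 / 480 \<le> truncated_form R b x} + prob {x. R \<le> frame_norm x}"
    by (intro measure_Un_le) measurable
  finally have "q \<le> prob {x. 1 / 480 \<le> truncated_form R b x}"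
    using prob_coordinate_form_ge[OF e_unit] prob_frame_norm_ge_le[OF R_pos] q_bounds(2) by linarith
  then show "q \<le> prob {x \<in> space \<mu>. 1 / 480 \<le> truncated_form R b x}" by simp
qed (use q_bounds in auto)

definition typical_points :: "real \<Rightarrow> real \<Rightarrow> (nat \<Rightarrow> real) set \<Rightarrow> (nat \<Rightarrow> real) set" where
  "typical_points R q T =
    {x \<in> Rn n. frame_norm x \<le> R \<and> (\<forall>b\<in>T. truncated_form R b x \<le> upper_quantile q (truncated_form R b))}"

definition quantile_caps :: "real \<Rightarrow> real \<Rightarrow> (nat \<Rightarrow> real) set \<Rightarrow> (nat \<Rightarrow> real) set set" where
  "quantile_caps R q T = (\<lambda>b. {x. upper_quantile q (truncated_form R b) \<le> truncated_form R b x}) ` T"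

lemma prob_typical_points_ge:
  assumes T: "finite T" and R: "0 < R" and q: "0 < q"
  shows "1 - real n / R - real (card T) * q \<le> prob (typical_points R q T)"
proof -
  let ?above = "\<lambda>b. {x. upper_quantile q (truncated_form R b) < truncated_form R b x}"
  let ?bad = "(- Rn n \<union> {x. R \<le> frame_norm x}) \<union> (\<Union>b\<in>T. ?above b)"
  have events: "- Rn n \<in> events" "{x. R \<le> frame_norm x} \<in> events" "?above b \<in> events" for b
    by (auto intro!: sets_Collect_mu)
  have typical: "typical_points R q T \<in> events"
    unfolding typical_points_def using T by (intro sets_Collect_mu) measurable
  have "prob (?above b) \<le> q" for b
    using prob_gt_upper_quantile[of "truncated_form R b" q] q by simp
  then have "(\<Sum>b\<in>T. prob (?above b)) \<le> real (card T) * q" by (rule sum_bounded_above)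
  moreover have "prob (\<Union>b\<in>T. ?above b) \<le> (\<Sum>b\<in>T. prob (?above b))"
    using T events by (intro finite_measure_subadditive_finite) auto
  moreover have "prob (- Rn n) = 0"
    using prob_compl[of "Rn n"] prob_Rn by (simp add: Compl_eq_Diff_UNIV)
  moreover have "prob ?bad \<le> prob (- Rn n) + prob {x. R \<le> frame_norm x} + prob (\<Union>b\<in>T. ?above b)"
  proof -
    have "prob ?bad \<le> prob (- Rn n \<union> {x. R \<le> frame_norm x}) + prob (\<Union>b\<in>T. ?above b)"
      using events T by (intro measure_Un_le sets.Un sets.finite_UN) auto
    also have "prob (- Rn n \<union> {x. R \<le> frame_norm x}) \<le> prob (- Rn n) + prob {x. R \<le> frame_norm x}"
      using events by (intro measure_Un_le) auto
    finally show ?thesis by simp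
  qed
  moreover have "1 - prob (typical_points R q T) \<le> prob ?bad"
  proof -
    have "space \<mu> - typical_points R q T \<subseteq> ?bad"
      by (auto simp: typical_points_def not_le)
    then have "prob (space \<mu> - typical_points R q T) \<le> prob ?bad"
      using events T by (intro finite_measure_mono sets.Un sets.finite_UN) auto
    then show ?thesis by (simp only: prob_compl[OF typical])
  qed
  ultimately show ?thesis using prob_frame_norm_ge_le[OF R] by linarith
qed

lemma separating_unit_direction:
  assumes N: "0 < N" and x: "x \<in> Rn n" "x \<notin> scaled_hull t N X" and X: "\<And>j. j < N \<Longrightarrow> X j \<in> Rn n"
  obtains e where "(\<Sum>j<n. (e j)\<^sup>2) = 1"
    and "\<And>j. j < N \<Longrightarrow> t * coordinate_form e (X j) < coordinate_form e x"
proof -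
  obtain a where a_separates: "\<And>j. j < N \<Longrightarrow> t * inner_Rn n a (X j) < inner_Rn n a x"
    using separating_functional_scaled_hull[OF N x X] by blast
  obtain c where c_coordinates: "inner_Rn n a = coordinate_form c"
    by (rule inner_Rn_eq_coordinate_form)
  define r where "r = sqrt (\<Sum>j<n. (c j)\<^sup>2)"
  have "(\<Sum>j<n. (c j)\<^sup>2) \<noteq> 0"
  proof
    assume "(\<Sum>j<n. (c j)\<^sup>2) = 0"
    then have "\<forall>j<n. c j = 0" by (subst (asm) sum_nonneg_eq_0_iff) auto
    then have "coordinate_form c y = 0" for y by (simp add: coordinate_form_eq_sum)
    then show False using a_separates[OF N] by (simp add: c_coordinates)
  qed
  then have r_norm: "0 < r" "r\<^sup>2 = (\<Sum>j<n. (c j)\<^sup>2)"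
    by (auto simp: r_def less_le sum_nonneg)
  show thesis
  proof (rule that[of "\<lambda>j. (1 / r) * c j"])
    have "(\<Sum>j<n. ((1 / r) * c j)\<^sup>2) = (\<Sum>j<n. (c j)\<^sup>2) / r\<^sup>2"
      by (simp add: power_divide sum_divide_distrib)
    also have "\<dots> = 1" using r_norm(1) unfolding r_norm(2)[symmetric] by simp
    finally show "(\<Sum>j<n. ((1 / r) * c j)\<^sup>2) = 1" .
    fix j assume "j < N"
    from mult_strict_left_mono[OF a_separates[OF this], of "1 / r"] r_norm
    show "t * coordinate_form (\<lambda>j. (1 / r) * c j) (X j) < coordinate_form (\<lambda>j. (1 / r) * c j) x"
      unfolding coordinate_form_scale c_coordinates by (simp add: mult_ac)
  qed
qed

lemma typical_points_subset_scaled_hull: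
  assumes pos: "0 < R" "0 < m" "0 < N" "0 < d" "d \<le> 1" "0 < q"
    and q: "real n / R + q \<le> 1 / 7200" and m: "8 * R / real m \<le> d / 240"
    and X: "X \<in> hitting_samples N (Rn n) (quantile_caps R q (direction_grid n m))"
  shows "typical_points R q (direction_grid n m) \<subseteq> scaled_hull (1 + d) N X"
proof (rule subsetI, rule ccontr)
  fix x
  assume x_uncovered: "x \<in> typical_points R q (direction_grid n m)"
    "x \<notin> scaled_hull (1 + d) N X"
  have x_Rn: "x \<in> Rn n" using x_uncovered(1) by (simp add: typical_points_def)
  have X_Rn: "X j \<in> Rn n" if "j < N" for j using X that by (simp add: hitting_samples_def)
  obtain e where e_unit: "(\<Sum>j<n. (e j)\<^sup>2) = 1"
    and sep: "\<And>j. j < N \<Longrightarrow> (1 + d) * coordinate_form e (X j) < coordinate_form e x"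
    using separating_unit_direction[OF pos(3) x_Rn x_uncovered(2) X_Rn] by blast
  have "\<exists>b\<in>direction_grid n m. \<forall>j<n. \<bar>b j - e j\<bar> \<le> 1 / real m"
    using pos(2) e_unit by (rule direction_grid_approximates)
  then obtain b where b_grid: "b \<in> direction_grid n m"
    and b_near: "\<forall>j<n. \<bar>b j - e j\<bar> \<le> 1 / real m" ..
  have near: "\<bar>b j - e j\<bar> \<le> 1 / real m" if "j < n" for j using b_near that by blast
  define s where "s = upper_quantile q (truncated_form R b)"
  have "8 * (R / real m) \<le> d / 240" using m by simp
  then have rounding_error: "R / real m \<le> d / 1920" "R / real m \<le> 1 / 1920"
    using pos(5) by linarith+
  have "1 / 480 \<le> s"
    unfolding s_def using pos q rounding_error
    by (intro quantile_truncated_form_ge[OF e_unit near]) auto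
  obtain j where hit: "j < N" "s \<le> truncated_form R b (X j)"
    using X b_grid by (auto simp: hitting_samples_def quantile_caps_def s_def)
  have sample_point: "frame_norm (X j) \<le> R" "s \<le> coordinate_form b (X j)"
    using hit(2) \<open>1 / 480 \<le> s\<close> by (auto simp: truncated_form_def split: if_splits)
  have x_bounds: "frame_norm x \<le> R" "coordinate_form b x \<le> s"
    using x_uncovered(1) b_grid
    by (auto simp: typical_points_def truncated_form_def s_def split: if_splits)
  have round: "\<bar>coordinate_form b y - coordinate_form e y\<bar> \<le> R / real m" if "frame_norm y \<le> R" for y
  proof -
    have "\<bar>coordinate_form b y - coordinate_form e y\<bar> \<le> 1 / real m * frame_norm y"
      by (rule coordinate_form_diff_le[OF near])
    also have "\<dots> \<le> R / real m" using that by (simp add: divide_right_mono)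
    finally show ?thesis .
  qed
  have "(1 + d) * coordinate_form e (X j) < coordinate_form e (X j) + 2 * (R / real m)"
    using sep[OF hit(1)] round[OF x_bounds(1)] round[OF sample_point(1)] x_bounds(2) sample_point(2)
    by linarith
  then have "d * coordinate_form e (X j) < 2 * (R / real m)" by (simp add: algebra_simps)
  moreover have "d * (1 / 960) \<le> d * coordinate_form e (X j)"
    using round[OF sample_point(1)] sample_point(2) \<open>1 / 480 \<le> s\<close> rounding_error(2) pos
    by (intro mult_left_mono) linarith+
  ultimately show False using rounding_error(1) by simp
qed

lemma expected_cover_ge_of_grid:
  assumes pos: "0 < R" "0 < m" "0 < N" "0 < d" "d \<le> 1" "0 < q" "q < 1"
    and q: "real n / R + q \<le> 1 / 7200" and m: "8 * R / real m \<le> d / 240"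
    and nonneg: "0 \<le> 1 - real n / R - (2 * real m + 1) ^ n * q"
  shows "(1 - real n / R - (2 * real m + 1) ^ n * q) * (1 - (2 * real m + 1) ^ n * (1 - q) ^ N)
    \<le> expected_cover \<mu> N d"
proof -
  let ?T = "direction_grid n m"
  let ?G = "typical_points R q ?T" and ?\<E> = "quantile_caps R q ?T"
  let ?\<Omega> = "hitting_samples N (Rn n) ?\<E>"
  have caps: "finite ?\<E>" "?\<E> \<subseteq> events" and prob_caps: "\<And>E. E \<in> ?\<E> \<Longrightarrow> q \<le> prob E"
    unfolding quantile_caps_def using pos prob_ge_upper_quantile[of "truncated_form R _" q]
    by (auto intro!: sets_Collect_mu finite_direction_grid)
  have Rn: "Rn n \<in> events" "prob (Rn n) = 1" by (auto simp: prob_Rn)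
  have "1 - real n / R - (2 * real m + 1) ^ n * q \<le> prob ?G"
    using prob_typical_points_ge[OF finite_direction_grid pos(1,6)]
      mult_right_mono[OF card_direction_grid_le[of n m], of q] pos(6) by (smt (verit))
  moreover have "1 - (2 * real m + 1) ^ n * (1 - q) ^ N \<le> measure (sample_measure N) ?\<Omega>"
  proof -
    have "card ?\<E> \<le> card ?T"
      unfolding quantile_caps_def by (rule card_image_le[OF finite_direction_grid])
    then have "real (card ?\<E>) \<le> (2 * real m + 1) ^ n"
      using card_direction_grid_le[of n m] by linarith
    then have "real (card ?\<E>) * (1 - q) ^ N \<le> (2 * real m + 1) ^ n * (1 - q) ^ N"
      using pos by (intro mult_right_mono) auto
    then show ?thesis using measure_hitting_samples_ge[OF caps Rn prob_caps, of N] by linarith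
  qed
  ultimately have "(1 - real n / R - (2 * real m + 1) ^ n * q) * (1 - (2 * real m + 1) ^ n * (1 - q) ^ N)
      \<le> prob ?G * measure (sample_measure N) ?\<Omega>"
    using nonneg by (intro order_trans[OF mult_left_mono mult_right_mono]) auto
  also have "\<dots> \<le> expected_cover \<mu> N d"
    using pos q m
    by (intro expected_cover_ge_mult sets_hitting_samples[OF caps Rn(1)]
        typical_points_subset_scaled_hull) auto
  finally show ?thesis .
qed

end

subsection \<open>The threshold for the number of points\<close>

lemma one_minus_power_le_inverse:
  fixes q :: real
  assumes "0 < q" "q \<le> 1" "0 < N"
  shows "(1 - q) ^ N \<le> 1 / (q * real N)"
proof -
  have "(1 - q) ^ N \<le> exp (- q) ^ N"
    using assms exp_ge_add_one_self[of "- q"] by (intro power_mono) auto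
  also have "\<dots> = 1 / exp (q * real N)"
    by (simp add: mult.commute flip: exp_of_nat_mult exp_minus inverse_eq_divide)
  also have "\<dots> \<le> 1 / (q * real N)"
  proof (rule divide_left_mono)
    show "q * real N \<le> exp (q * real N)" using exp_ge_add_one_self[of "q * real N"] by linarith
  qed (use assms in auto)
  finally show ?thesis .
qed

lemma grid_size_le_power:
  assumes "3 \<le> n"
  shows "(2 * real (n ^ 4) + 1) ^ n \<le> real n ^ (5 * n)"
proof -
  have "2 * real (n ^ 4) + 1 \<le> 3 * real n ^ 4"
    using one_le_power[of "real n" 4] assms by simp
  also have "\<dots> \<le> real n * real n ^ 4" using assms by (intro mult_right_mono) auto
  also have "\<dots> = real n ^ 5" by (simp add: eval_nat_numeral)
  finally have "(2 * real (n ^ 4) + 1) ^ n \<le> (real n ^ 5) ^ n" by (intro power_mono) auto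
  then show ?thesis by (simp add: power_mult)
qed

lemma union_bounds_le:
  fixes n N :: nat
  defines "K \<equiv> (2 * real (n ^ 4) + 1) ^ n" and "q \<equiv> 1 / real n ^ (6 * n)"
  assumes n: "3 \<le> n" and N: "real n ^ (12 * n) \<le> real N"
  shows "K * q \<le> 1 / real n" and "K * (1 - q) ^ N \<le> 1 / real n"
proof -
  have pos: "0 < real n" using n by simp
  have "real n ^ 1 \<le> real n ^ n" using n by (intro power_increasing) auto
  then have small: "1 / real n ^ n \<le> 1 / real n" using pos by (intro divide_left_mono) auto
  have K: "0 \<le> K" "K \<le> real n ^ (5 * n)" using grid_size_le_power[OF n] by (auto simp: K_def)
  have q: "0 < q" "q \<le> 1" using n by (auto simp: q_def)
  have "K * q \<le> real n ^ (5 * n) * q" using K q by (intro mult_right_mono) auto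
  also have "\<dots> = 1 / real n ^ n"
    using pos power_add[of "real n" "5 * n" n] by (simp add: q_def)
  also note small
  finally show "K * q \<le> 1 / real n" .
  have N_pos: "0 < real N" using N zero_less_power[OF pos, of "12 * n"] by linarith
  have "(1 - q) ^ N \<le> 1 / (q * real N)"
    using q N_pos by (intro one_minus_power_le_inverse) auto
  also have "\<dots> \<le> 1 / (q * real n ^ (12 * n))"
    using q N N_pos pos by (intro divide_left_mono mult_left_mono mult_pos_pos) auto
  finally have "K * (1 - q) ^ N \<le> real n ^ (5 * n) * (1 / (q * real n ^ (12 * n)))"
    using K q by (intro mult_mono) auto
  also have "\<dots> = 1 / real n ^ n"
  proof -
    have "real n ^ (12 * n) = real n ^ (5 * n) * real n ^ (6 * n) * real n ^ n"
      by (simp flip: power_add)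
    then show ?thesis using pos by (simp add: q_def)
  qed
  also note small
  finally show "K * (1 - q) ^ N \<le> 1 / real n" .
qed

lemma (in centered_log_concave) expected_cover_ge:
  assumes d: "0 < d" "d < 1" and n: "14400 \<le> n" "1920 / real n \<le> d"
    and N: "real n ^ (12 * n) \<le> real N"
  shows "1 - 3 / real n \<le> expected_cover \<mu> N d"
proof -
  obtain u where "isotropic_frame n \<mu> u" by (rule isotropic_frame_exists)
  then interpret isotropic_frame n \<mu> u .
  define K where "K = (2 * real (n ^ 4) + 1) ^ n"
  define q where "q = 1 / real n ^ (6 * n)"
  have n_real: "0 < real n" "14400 \<le> real n" using n by auto
  have K_q_le: "K * q \<le> 1 / real n" and K_miss_le: "K * (1 - q) ^ N \<le> 1 / real n"
    using union_bounds_le[of n N] n N by (auto simp: K_def q_def)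
  have "real n ^ 1 < real n ^ (6 * n)" using n by (intro power_strict_increasing) auto
  then have q: "0 < q" "q < 1 / real n"
    using n_real by (auto simp: q_def intro!: divide_strict_left_mono)
  have inverse: "real n / (real n)\<^sup>2 = 1 / real n" "1 / real n \<le> 1 / 14400"
      "2 / real n = 1 / real n + 1 / real n"
    using n_real by (simp_all add: power2_eq_square)
  have "1 - 3 / real n \<le> (1 - 2 / real n) * (1 - 1 / real n)"
    using n_real(1) by (simp add: field_simps)
  also have "\<dots> \<le> (1 - real n / (real n)\<^sup>2 - K * q) * (1 - K * (1 - q) ^ N)"
    using K_q_le K_miss_le inverse by (intro mult_mono) linarith+
  also have "\<dots> \<le> expected_cover \<mu> N d"
    unfolding K_def
  proof (rule expected_cover_ge_of_grid)
    show "real n / (real n)\<^sup>2 + q \<le> 1 / 7200" "q < 1" using inverse q by linarith+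
    have "8 * (real n)\<^sup>2 / real (n ^ 4) = 8 / real n * (1 / real n)"
      using n_real(1) by (simp add: power2_eq_square power4_eq_xxxx)
    also have "\<dots> \<le> 8 / real n * 1" using n_real by (intro mult_left_mono) auto
    also have "\<dots> \<le> d / 240" using n(2) by simp
    finally show "8 * (real n)\<^sup>2 / real (n ^ 4) \<le> d / 240" .
    show "0 \<le> 1 - real n / (real n)\<^sup>2 - (2 * real (n ^ 4) + 1) ^ n * q"
      using K_q_le inverse unfolding K_def by linarith
    have "0 < real N" using N zero_less_power[OF n_real(1), of "12 * n"] by linarith
    then show "0 < N" by simp
  qed (use n n_real d q in auto)
  finally show ?thesis .
qed

definition worst_expected_cover :: "real \<Rightarrow> real \<Rightarrow> nat \<Rightarrow> real" where
  "worst_expected_cover C d n =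
    Inf {Inf {expected_cover \<mu> N d | N::nat.
                real N \<ge> exp (C * (1 / d) * ln (2 / d) * real n * ln (real n))}
         | \<mu>. log_concave_prob n \<mu> \<and> barycenter_origin n \<mu>}"

lemma sample_sizes_nonempty: "{expected_cover \<mu> N d | N::nat. real N \<ge> t} \<noteq> {}"
  using real_arch_simple[of t] by blast

lemma worst_expected_cover_le_1: "worst_expected_cover C d n \<le> 1"
proof -
  define t where "t = exp (C * (1 / d) * ln (2 / d) * real n * ln (real n))"
  let ?covers = "\<lambda>\<mu>. {expected_cover \<mu> N d | N::nat. real N \<ge> t}"
  have covers_bdd: "bdd_below (?covers \<mu>)" and Inf_nonneg: "0 \<le> Inf (?covers \<mu>)" for \<mu>
    using expected_cover_nonneg sample_sizes_nonempty[of \<mu> d t]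
    by (auto intro!: cInf_greatest bdd_belowI[where m = 0])
  interpret cube: log_concave n "cube_measure n" by standard (rule log_concave_prob_cube)
  have "worst_expected_cover C d n \<le> Inf (?covers (cube_measure n))"
    unfolding worst_expected_cover_def t_def[symmetric]
    using log_concave_prob_cube barycenter_origin_cube Inf_nonneg
    by (intro cInf_lower bdd_belowI[where m = 0]) auto
  also obtain v where "v \<in> ?covers (cube_measure n)" using sample_sizes_nonempty by blast
  then have "Inf (?covers (cube_measure n)) \<le> v" using covers_bdd by (rule cInf_lower)
  also have "v \<le> 1" using \<open>v \<in> ?covers (cube_measure n)\<close> cube.expected_cover_le_1 by auto
  finally show ?thesis .
qed

lemma power_le_sample_threshold:
  assumes d: "0 < d" "d < 1" and n: "0 < n"
  shows "real n ^ (12 * n) \<le> exp (18 * (1 / d) * ln (2 / d) * real n * ln (real n))"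
proof -
  have "12 \<le> 18 * (1 * ln (2::real))" using ln2_ge_two_thirds by simp
  also have "\<dots> \<le> 18 * ((1 / d) * ln (2 / d))"
    using d by (intro mult_left_mono mult_mono) (auto simp: field_simps)
  finally have "12 * (real n * ln (real n)) \<le> 18 * ((1 / d) * ln (2 / d)) * (real n * ln (real n))"
    using n by (intro mult_right_mono) auto
  moreover have "real n ^ (12 * n) = exp (12 * (real n * ln (real n)))"
    using n by (simp add: exp_of_nat_mult[symmetric] powr_realpow[symmetric] powr_def)
  ultimately show ?thesis by (simp add: mult.assoc)
qed

lemma worst_expected_cover_ge:
  assumes d: "0 < d" "d < 1" and n: "14400 \<le> n" "1920 / real n \<le> d"
  shows "1 - 3 / real n \<le> worst_expected_cover 18 d n"
  unfolding worst_expected_cover_def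
proof (rule cInf_greatest)
  let ?t = "exp (18 * (1 / d) * ln (2 / d) * real n * ln (real n))"
  show "{Inf {expected_cover \<mu> N d | N::nat. real N \<ge> ?t}
      | \<mu>. log_concave_prob n \<mu> \<and> barycenter_origin n \<mu>} \<noteq> {}"
    using log_concave_prob_cube barycenter_origin_cube by blast
  fix v assume "v \<in> {Inf {expected_cover \<mu> N d | N::nat. real N \<ge> ?t}
      | \<mu>. log_concave_prob n \<mu> \<and> barycenter_origin n \<mu>}"
  then obtain \<mu> where v: "v = Inf {expected_cover \<mu> N d | N::nat. real N \<ge> ?t}"
    and \<mu>: "log_concave_prob n \<mu>" "barycenter_origin n \<mu>" by blast
  interpret centered_log_concave n \<mu> using \<mu> by unfold_locales
  have "0 < n" using n(1) by linarith
  then have "1 - 3 / real n \<le> expected_cover \<mu> N d" if "?t \<le> real N" for N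
    using power_le_sample_threshold[OF d] that
    by (intro expected_cover_ge[OF d n]) (rule order_trans)
  then show "1 - 3 / real n \<le> v"
    unfolding v using sample_sizes_nonempty by (intro cInf_greatest) auto
qed

theorem theorem1p6:
  shows "\<exists>C>0. \<forall>d::real. 0 < d \<and> d < 1 \<longrightarrow>
    (\<lambda>n::nat. Inf {Inf {expected_cover \<mu> N d | N::nat.
                         real N \<ge> exp (C * (1 / d) * ln (2 / d) * real n * ln (real n))}
                   | \<mu>. log_concave_prob n \<mu> \<and> barycenter_origin n \<mu>})
    \<longlonglongrightarrow> 1"
  unfolding worst_expected_cover_def[symmetric]
proof (intro exI[of _ 18] conjI allI impI)
  fix d :: real assume d: "0 < d \<and> d < 1"
  have "\<forall>\<^sub>F n in sequentially. 1920 / real n < d"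
    using d by (intro order_tendstoD(2)[OF lim_const_over_n]) simp
  then have lower: "\<forall>\<^sub>F n in sequentially. 1 - 3 / real n \<le> worst_expected_cover 18 d n"
    using eventually_ge_at_top[of 14400]
  proof eventually_elim
    case (elim n)
    with d show ?case by (intro worst_expected_cover_ge) simp_all
  qed
  have upper: "\<forall>\<^sub>F n in sequentially. worst_expected_cover 18 d n \<le> 1"
    by (simp add: worst_expected_cover_le_1)
  have "(\<lambda>n. 1 - 3 / real n) \<longlonglongrightarrow> 1 - 0"
    by (intro tendsto_diff tendsto_const lim_const_over_n)
  then have "(\<lambda>n. 1 - 3 / real n) \<longlonglongrightarrow> 1" by simp
  then show "(\<lambda>n. worst_expected_cover 18 d n) \<longlonglongrightarrow> 1"
    by (rule tendsto_sandwich[OF lower upper _ tendsto_const])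
qed simp

end
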